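(* Let $0\le\rho<1$, $0\le\delta\le 1$, and let $1\le p,p_1,p_2<\infty$ satisfy $\frac1p=\frac1{p_1}+\frac1{p_2}$. Then there exist symbols $\sigma\in BS^0_{\rho,\delta}$ such that the operator $T_\sigma$ is unbounded from $L^{p_1}\times L^{p_2}$ into $L^p$; that is, there is no constant $C$ with $\|T_\sigma(f,g)\|_{L^p}\le C\|f\|_{L^{p_1}}\|g\|_{L^{p_2}}$ for all $f,g\in\mathcal S$.
   Context: All function spaces are over $\mathbb R^n$; $\mathcal S$ is the Schwartz class and $\widehat f$ is the Fourier transform of $f$. For $m\in\mathbb R$ and $\rho,\delta\ge 0$, the bilinear Hörmander class $BS^m_{\rho,\delta}$ consists of all smooth functions $\sigma(x,\xi,\eta)$, $x,\xi,\eta\in\mathbb R^n$, such that for all multi-indices $\alpha,\beta,\gamma$, $$\sup_{x,\xi,\eta\in\mathbb R^n}|\partial_x^\alpha\partial_\xi^\beta\partial_\eta^\gamma\sigma(x,\xi,\eta)|\,(1+|\xi|+|\eta|)^{-m-\delta|\alpha|+\rho(|\beta|+|\gamma|)}<\infty.$$ The bilinear pseudodifferential operator with symbol $\sigma$ is $$T_\sigma(f,g)(x)=\int_{\mathbb R^n}\int_{\mathbb R^n}\sigma(x,\xi,\eta)\widehat f(\xi)\widehat g(\eta)e^{ix\cdot(\xi+\eta)}\,d\xi\,d\eta,\qquad f,g\in\mathcal S.$$ *)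

theory Defs
  imports "HOL-Analysis.Analysis"
begin

definition dir_deriv :: "'a::real_normed_vector \<Rightarrow> ('a \<Rightarrow> 'b::real_normed_vector) \<Rightarrow> 'a \<Rightarrow> 'b" where
  "dir_deriv v f x = vector_derivative (\<lambda>t. f (x + t *\<^sub>R v)) (at 0)"

text \<open>
  Being infinitely often differentiable: every iterated partial derivative is totally
  differentiable, so all partial derivatives of all orders exist and are continuous.
\<close>
definition smooth :: "('a::euclidean_space \<Rightarrow> 'b::real_normed_vector) \<Rightarrow> bool" where
  "smooth f \<longleftrightarrow> (\<forall>vs. set vs \<subseteq> Basis \<longrightarrow> (\<forall>x. foldr dir_deriv vs f differentiable (at x)))"

text \<open>
  A multi-index is a function \<open>\<alpha> :: 'n \<Rightarrow> nat\<close> on a finite index type, and \<open>e i\<close> is the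
  direction of the \<open>i\<close>-th variable of the block in which the derivative is taken. The chosen
  word only fixes the order of differentiation, which is immaterial for smooth \<open>f\<close>.
\<close>
definition multi_deriv ::
  "('n::finite \<Rightarrow> 'a::real_normed_vector) \<Rightarrow> ('n \<Rightarrow> nat) \<Rightarrow> ('a \<Rightarrow> 'b::real_normed_vector) \<Rightarrow> 'a \<Rightarrow> 'b"
  where
  "multi_deriv e \<alpha> f = foldr (\<lambda>i. dir_deriv (e i)) (SOME w. \<forall>i. count_list w i = \<alpha> i) f"

definition mi_order :: "('n::finite \<Rightarrow> nat) \<Rightarrow> nat" where
  "mi_order \<alpha> = (\<Sum>i\<in>UNIV. \<alpha> i)"

definition schwartz :: "((real ^ 'n) \<Rightarrow> complex) set" where
  "schwartz = {f. smooth f \<and>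
     (\<forall>\<alpha> \<beta>. \<exists>C. \<forall>x. norm (of_real (\<Prod>i\<in>UNIV. x $ i ^ \<alpha> i) *
        multi_deriv (\<lambda>i. axis i 1) \<beta> f x) \<le> C)}"

text \<open>Normalisation without a factor in front of the integral.\<close>
definition fourier :: "((real ^ 'n) \<Rightarrow> complex) \<Rightarrow> (real ^ 'n) \<Rightarrow> complex" where
  "fourier f \<xi> = (LINT x|lborel. f x * exp (- \<i> * of_real (x \<bullet> \<xi>)))"

text \<open>A symbol \<open>\<sigma>(x, \<xi>, \<eta>)\<close> is a function on the product of three copies of the space.\<close>
definition BS :: "real \<Rightarrow> real \<Rightarrow> real \<Rightarrow> ((real ^ 'n) \<times> (real ^ 'n) \<times> (real ^ 'n) \<Rightarrow> complex) set" where
  "BS m \<rho> \<delta> = {\<sigma>. smooth \<sigma> \<and>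
     (\<forall>\<alpha> \<beta> \<gamma>. \<exists>C. \<forall>x \<xi> \<eta>.
        norm (multi_deriv (\<lambda>i. (axis i 1, 0, 0)) \<alpha>
               (multi_deriv (\<lambda>i. (0, axis i 1, 0)) \<beta>
                 (multi_deriv (\<lambda>i. (0, 0, axis i 1)) \<gamma> \<sigma>)) (x, \<xi>, \<eta>))
        * (1 + norm \<xi> + norm \<eta>) powr
            (- m - \<delta> * real (mi_order \<alpha>) + \<rho> * (real (mi_order \<beta>) + real (mi_order \<gamma>))) \<le> C)}"

definition bilinear_op ::
  "((real ^ 'n) \<times> (real ^ 'n) \<times> (real ^ 'n) \<Rightarrow> complex) \<Rightarrow>
    ((real ^ 'n) \<Rightarrow> complex) \<Rightarrow> ((real ^ 'n) \<Rightarrow> complex) \<Rightarrow> (real ^ 'n) \<Rightarrow> complex" where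
  "bilinear_op \<sigma> f g x =
     (LINT \<eta>|lborel. LINT \<xi>|lborel.
        \<sigma> (x, \<xi>, \<eta>) * fourier f \<xi> * fourier g \<eta> * exp (\<i> * of_real (x \<bullet> (\<xi> + \<eta>))))"

text \<open>
  The norm takes the value \<open>\<infinity>\<close> on functions that are not in \<open>L\<^sup>p\<close>; a real-valued Bochner
  integral would give them norm 0.
\<close>
definition Lp_norm :: "real \<Rightarrow> ((real ^ 'n) \<Rightarrow> complex) \<Rightarrow> ennreal" where
  "Lp_norm p f =
     (let I = (\<integral>\<^sup>+ x. ennreal (norm (f x) powr p) \<partial>lborel)
      in if I = \<infinity> then \<infinity> else ennreal (enn2real I powr (1 / p)))"

end

theory Submission
  imports Defs "HOL-Complex_Analysis.Cauchy_Integral_Theorem" "HOL-Probability.Distributions"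
    "HOL-Real_Asymp.Real_Asymp"
begin

text \<open>
The symbol is \<open>\<sigma> = exp (i \<Phi>)\<close> with \<open>\<Phi>(\<xi>, \<eta>) = \<xi>\<^sub>j (1 + |\<xi>|\<^sup>2 + |\<eta>|\<^sup>2) powr ((s - 1) / 2)\<close>, where
\<open>0 < s \<le> 1 - \<rho>\<close> and \<open>s < 1\<close>. The phase has order \<open>s\<close>, so a derivative of \<open>\<sigma>\<close> in \<open>\<xi>\<close> or \<open>\<eta>\<close>
brings a factor of order \<open>s - 1 \<le> -\<rho>\<close>, while derivatives in \<open>x\<close> vanish. Hence \<open>\<sigma>\<close> lies in the class
(\<open>osc_symbol_in_BS\<close>).

The reason for unboundedness is what \<open>\<sigma>\<close> looks like near \<open>(0, N e\<^sub>j)\<close> for large \<open>N\<close>. Put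
\<open>\<xi> = L u\<close> and \<open>\<eta> = N e\<^sub>j + L v\<close>. Up to terms that are small for large \<open>N\<close>, \<open>\<Phi>\<close> is then a linear
term in \<open>u\<^sub>j\<close>, plus \<open>(s - 1) L\<^sup>2 N powr (s - 2) u\<^sub>j v\<^sub>j\<close>, plus terms of third order. With \<open>L\<close> a suitable
multiple of \<open>N powr (1 - s / 2)\<close> the quadratic term is \<open>- u\<^sub>j v\<^sub>j\<close>, while the remainder tends to
zero because \<open>L / N \<rightarrow> 0\<close> (\<open>rescaled_phase_tendsto\<close>). Modulating \<open>g\<close> moves its frequencies to \<open>N e\<^sub>j\<close>,
translating \<open>f\<close> removes the linear term, and dilating both by \<open>L\<close> does not change the quotient
of the norms since \<open>1 / p = 1 / p1 + 1 / p2\<close>. So by dominated convergence and Fatou's lemma a bound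
for \<open>T\<^sub>\<sigma>\<close> is inherited by the operator with symbol \<open>exp (- i u\<^sub>j v\<^sub>j)\<close> (\<open>limit_op_bounded\<close>).

The limit operator is unbounded, and Gaussian chirps show it. Let the Fourier transform of
\<open>f = g\<close> be \<open>exp (- (\<mu> + i) u\<^sub>j\<^sup>2 / 2)\<close> in the variable \<open>u\<^sub>j\<close>, with small \<open>\<mu> > 0\<close>, and a
fixed Gaussian in the others. The phases add up to \<open>- (u\<^sub>j + v\<^sub>j)\<^sup>2 / 2\<close>, a function of the sum alone;
the integral over \<open>u\<^sub>j - v\<^sub>j\<close> is then free of oscillation and contributes a factor
proportional to \<open>1 / sqrt \<mu>\<close>, which is also the length of the frequency range of \<open>f\<close>. All
functions involved are Gaussians of width proportional to \<open>1 / sqrt \<mu>\<close> in \<open>x\<^sub>j\<close>, so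
the widths cancel by the relation between the exponents and the quotient of the norms is at least
a constant times \<open>1 / sqrt \<mu>\<close> (\<open>norm_limit_op_chirp\<close>, \<open>limit_op_unbounded\<close>).

Everything about chirps is explicit once the integral of \<open>exp (- z x\<^sup>2 / 2 + w x)\<close> is known for
complex \<open>z\<close> with positive real part (\<open>complex_gaussian_integral\<close>).
\<close>

section \<open>Iterated directional derivatives\<close>

text \<open>
Both \<open>smooth\<close> and the estimates with multi-indices become statements about words of directions.
The word that \<open>multi_deriv\<close> picks is the same for all functions, so nested uses concatenate to one word.
\<close>
lemma multi_deriv_word:
  fixes e :: "'n::finite \<Rightarrow> 'a::real_normed_vector"
  obtains vs where "set vs \<subseteq> range e" "length vs = mi_order \<alpha>"
    "\<And>f::'a \<Rightarrow> 'b::real_normed_vector. multi_deriv e \<alpha> f = foldr dir_deriv vs f"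
proof -
  have ex: "\<exists>w. \<forall>i. count_list w i = \<alpha> i"
  proof -
    obtain xs where xs: "set xs = (UNIV::'n set)" "distinct xs"
      using finite_distinct_list[of "UNIV::'n set"] by auto
    have "count_list (concat (map (\<lambda>i. replicate (\<alpha> i) i) ys)) j = (if j \<in> set ys then \<alpha> j else 0)"
      if "distinct ys" for ys j
      using that
    proof (induction ys)
      case (Cons y ys)
      have "count_list (replicate k y) j = (if j = y then k else 0)" for k
        by (induction k) auto
      with Cons show ?case by auto
    qed auto
    from this[OF xs(2)] show ?thesis using xs(1) by (metis UNIV_I)
  qed
  \<comment> \<open>the very word that \<open>multi_deriv\<close> chooses\<close>
  define w where "w = (SOME w. \<forall>i. count_list w i = \<alpha> i)"
  have w: "count_list w i = \<alpha> i" for i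
    using someI_ex[OF ex] unfolding w_def by blast
  have len: "length w = mi_order \<alpha>"
  proof -
    have "(\<Sum>i\<in>UNIV. count_list w i) = length w"
      using sum_count_set[of w UNIV] by auto
    then show ?thesis by (simp add: w mi_order_def)
  qed
  have "multi_deriv e \<alpha> f = foldr dir_deriv (map e w) f" for f :: "'a \<Rightarrow> 'b"
    unfolding multi_deriv_def w_def[symmetric] by (simp add: foldr_map o_def)
  then show thesis
    using len that[of "map e w"] by auto
qed

lemma dir_deriv_eq:
  assumes "(f has_derivative f') (at x)"
  shows "dir_deriv v f x = f' v"
proof -
  have "((\<lambda>t. f (x + t *\<^sub>R v)) has_derivative (\<lambda>t. f' (t *\<^sub>R v))) (at 0)"
  proof (rule has_derivative_compose[where f = "\<lambda>t. x + t *\<^sub>R v" and g = f])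
    show "((\<lambda>t. x + t *\<^sub>R v) has_derivative (\<lambda>t. t *\<^sub>R v)) (at 0)"
      by (auto intro!: derivative_eq_intros)
  qed (use assms in simp)
  moreover have "f' (t *\<^sub>R v) = t *\<^sub>R f' v" for t
    using assms by (simp add: has_derivative_def bounded_linear.linear linear_scale)
  ultimately show ?thesis
    unfolding dir_deriv_def by (intro vector_derivative_at) (simp add: has_vector_derivative_def)
qed

section \<open>An oscillatory symbol in the bilinear Hoermander class\<close>

type_synonym 'n phase_space = "(real ^ 'n) \<times> (real ^ 'n) \<times> (real ^ 'n)"

text \<open>
A smooth substitute for \<open>(1 + |\<xi>| + |\<eta>|)\<^sup>2\<close>, to which it is comparable. A symbol of order \<open>m\<close> is
therefore bounded by a multiple of \<open>weight z powr (m / 2)\<close>.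
\<close>
definition weight :: "'n::finite phase_space \<Rightarrow> real" where
  "weight z = 1 + (norm (fst (snd z)))\<^sup>2 + (norm (snd (snd z)))\<^sup>2"

definition coord :: "'n::finite \<Rightarrow> 'n phase_space \<Rightarrow> real" where
  "coord j z = fst (snd z) $ j"

definition phase :: "'n::finite \<Rightarrow> real \<Rightarrow> 'n phase_space \<Rightarrow> real" where
  "phase j s z = coord j z * weight z powr ((s - 1) / 2)"

definition osc_symbol :: "'n::finite \<Rightarrow> real \<Rightarrow> 'n phase_space \<Rightarrow> complex" where
  "osc_symbol j s z = exp (\<i> * of_real (phase j s z))"

text \<open>
An algebra of functions, each with an upper bound \<open>m\<close> for its order of growth, that contains the
oscillatory symbol and is closed under differentiation. Working with generators replaces estimates
for derivatives of arbitrary length by one induction over the rules.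
\<close>
inductive symbol_order :: "'n::finite \<Rightarrow> real \<Rightarrow> real \<Rightarrow> ('n phase_space \<Rightarrow> complex) \<Rightarrow> bool"
  for j s where
  const: "symbol_order j s 0 (\<lambda>_. c)"
| lin: "symbol_order j s 1 (\<lambda>z. of_real (snd z \<bullet> b))"
| wt: "symbol_order j s t (\<lambda>z. of_real (weight z powr (t / 2)))"
| expo: "symbol_order j s 0 (osc_symbol j s)"
| mono: "symbol_order j s m f \<Longrightarrow> m \<le> m' \<Longrightarrow> symbol_order j s m' f"
| add: "symbol_order j s m f \<Longrightarrow> symbol_order j s m g \<Longrightarrow> symbol_order j s m (\<lambda>z. f z + g z)"
| mult: "symbol_order j s m f \<Longrightarrow> symbol_order j s m' g \<Longrightarrow> symbol_order j s (m + m') (\<lambda>z. f z * g z)"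

lemma weight_ge_1: "1 \<le> weight z"
  by (simp add: weight_def)

lemma weight_eq: "weight z = 1 + snd z \<bullet> snd z"
  by (cases z) (simp add: weight_def inner_prod_def dot_square_norm)

lemma symbol_order_bounded:
  assumes "symbol_order j s m f"
  shows "\<exists>C. \<forall>z. norm (f z) \<le> C * weight z powr (m / 2)"
  using assms
proof induction
  case (const c)
  have "weight z \<noteq> 0" for z :: "'a phase_space"
    using weight_ge_1[of z] by linarith
  then show ?case by (intro exI[of _ "norm c"]) auto
next
  case (lin b)
  have "norm (complex_of_real (snd z \<bullet> b)) \<le> norm b * weight z powr (1/2)" for z :: "'a phase_space"
  proof -
    have "\<bar>snd z \<bullet> b\<bar> \<le> norm (snd z) * norm b" by (rule Cauchy_Schwarz_ineq2)
    also have "norm (snd z) \<le> weight z powr (1/2)"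
      using weight_ge_1[of z] by (simp add: powr_half_sqrt weight_eq real_le_rsqrt dot_square_norm)
    finally show ?thesis by (simp add: mult.commute mult_right_mono)
  qed
  then show ?case by blast
next
  case (wt t)
  show ?case by (rule exI[of _ 1]) auto
next
  case expo
  have "weight z \<noteq> 0" for z :: "'a phase_space"
    using weight_ge_1[of z] by linarith
  then show ?case by (intro exI[of _ 1]) (auto simp: osc_symbol_def)
next
  case (mono m f m')
  then obtain C where C: "\<And>z. norm (f z) \<le> C * weight z powr (m / 2)" by blast
  have "norm (f z) \<le> \<bar>C\<bar> * weight z powr (m' / 2)" for z
  proof -
    have "norm (f z) \<le> \<bar>C\<bar> * weight z powr (m / 2)"
      using C[of z] by (meson abs_ge_self mult_right_mono order.trans powr_ge_zero)
    also have "\<dots> \<le> \<bar>C\<bar> * weight z powr (m' / 2)"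
      using mono weight_ge_1[of z] by (intro mult_left_mono powr_mono) auto
    finally show ?thesis .
  qed
  then show ?case by blast
next
  case (add m f g)
  then obtain C D where "\<And>z. norm (f z) \<le> C * weight z powr (m / 2)"
    "\<And>z. norm (g z) \<le> D * weight z powr (m / 2)" by blast
  then have "norm (f z + g z) \<le> (C + D) * weight z powr (m / 2)" for z
    by (metis (no_types, lifting) add_mono distrib_right norm_triangle_le)
  then show ?case by blast
next
  case (mult m f m' g)
  then obtain C D where C: "\<And>z. norm (f z) \<le> C * weight z powr (m / 2)"
    and D: "\<And>z. norm (g z) \<le> D * weight z powr (m' / 2)" by blast
  have "norm (f z * g z) \<le> (C * D) * weight z powr ((m + m') / 2)" for z
  proof -
    have "norm (f z * g z) \<le> (C * weight z powr (m / 2)) * (D * weight z powr (m' / 2))"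
      unfolding norm_mult by (intro mult_mono C D order.trans[OF norm_ge_zero C]) auto
    then show ?thesis by (simp add: add_divide_distrib powr_add mult_ac)
  qed
  then show ?case by blast
qed

lemma symbol_order_zero: "symbol_order j s m (\<lambda>_. 0)"
  using symbol_order.mult[OF symbol_order.wt[of j s m] symbol_order.const[of j s 0]] by simp

lemma symbol_order_cmult: "symbol_order j s m f \<Longrightarrow> symbol_order j s m (\<lambda>z. c * f z)"
  using symbol_order.mult[OF symbol_order.const[of j s c]] by fastforce

lemma coord_eq: "coord j z = snd z \<bullet> (axis j 1, 0)"
  by (cases z) (simp add: coord_def inner_axis)

lemma symbol_order_weight: "symbol_order j s (2 * t) (\<lambda>z. of_real (weight z powr t))"
  using symbol_order.wt[of j s "2 * t"] by simp

lemma weight_has_derivative: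
  "((\<lambda>z. weight z powr t) has_derivative
     (\<lambda>v. 2 * t * weight z powr (t - 1) * (snd z \<bullet> snd v))) (at z)"
proof -
  have "weight z > 0" using weight_ge_1[of z] by linarith
  then show ?thesis
    unfolding weight_eq
    by (auto intro!: derivative_eq_intros ext
        simp: powr_diff inner_commute field_simps)
qed

lemma coord_has_derivative: "(coord j has_derivative coord j) (at z)"
  unfolding coord_eq[abs_def] by (auto intro!: derivative_eq_intros)

lemma phase_has_derivative:
  "(phase j s has_derivative
     (\<lambda>v. coord j v * weight z powr ((s - 1) / 2)
        + (s - 1) * (coord j z * weight z powr ((s - 3) / 2)) * (snd z \<bullet> snd v))) (at z)"
proof -
  have e: "(s - 1) / 2 - 1 = (s - 3) / 2" by (simp add: field_simps)
  show ?thesis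
    unfolding phase_def[abs_def]
    by (rule has_derivative_eq_rhs[OF has_derivative_mult[OF coord_has_derivative weight_has_derivative]])
       (simp add: fun_eq_iff e field_simps)
qed

lemma osc_symbol_has_derivative:
  "(osc_symbol j s has_derivative
     (\<lambda>v. \<i> * (of_real (coord j v) * of_real (weight z powr ((s - 1) / 2))
        + of_real (s - 1) * of_real (coord j z * weight z powr ((s - 3) / 2)) * of_real (snd z \<bullet> snd v))
       * osc_symbol j s z)) (at z)"
proof -
  have "((\<lambda>z. exp (\<i> * of_real (phase j s z))) has_derivative
     (\<lambda>v. exp (\<i> * of_real (phase j s z)) * (\<i> * of_real (coord j v * weight z powr ((s - 1) / 2)
        + (s - 1) * (coord j z * weight z powr ((s - 3) / 2)) * (snd z \<bullet> snd v))))) (at z)"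
    by (rule has_derivative_eq_rhs, rule has_derivative_compose[OF _ has_field_derivative_imp_has_derivative[OF DERIV_exp]],
        rule has_derivative_mult_right, rule has_derivative_of_real, rule phase_has_derivative) simp
  then show ?thesis
    unfolding osc_symbol_def[abs_def] by (rule has_derivative_eq_rhs) (auto simp: algebra_simps)
qed

text \<open>
Differentiating a coordinate or a power of the weight lowers the order by \<open>1\<close>, and
differentiating \<open>exp (i \<Phi>)\<close> multiplies it by a derivative of \<open>\<Phi>\<close>, which has order \<open>s - 1\<close>. So
each derivative gains every \<open>r\<close> up to the minimum of \<open>1\<close> and \<open>1 - s\<close>, and the product rule preserves the gain.
\<close>
lemma symbol_order_dir_deriv:
  assumes "symbol_order j s m f" and r: "r \<le> 1" "r \<le> 1 - s"
  shows "(\<forall>z. f differentiable at z) \<and> (\<forall>v. symbol_order j s (m - r) (dir_deriv v f))"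
  using assms(1)
proof induction
  case (const c)
  have "dir_deriv v (\<lambda>_. c) = (\<lambda>_. 0)" for v :: "'a phase_space"
    using dir_deriv_eq[OF has_derivative_const] by fastforce
  then show ?case by (auto simp: symbol_order_zero)
next
  case (lin b)
  have d: "((\<lambda>z. complex_of_real (snd z \<bullet> b)) has_derivative (\<lambda>v. of_real (snd v \<bullet> b))) (at z)"
    for z :: "'a phase_space"
    by (auto intro!: derivative_eq_intros)
  have "dir_deriv v (\<lambda>z. complex_of_real (snd z \<bullet> b)) = (\<lambda>z. of_real (snd v \<bullet> b))" for v :: "'a phase_space"
    using dir_deriv_eq[OF d] by blast
  moreover have "symbol_order j s (1 - r) (\<lambda>_. c)" for c
    using r by (intro symbol_order.mono[OF symbol_order.const]) simp
  ultimately show ?case using differentiableI[OF d] by metis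
next
  case (wt t)
  have d: "((\<lambda>z. complex_of_real (weight z powr (t / 2))) has_derivative
     (\<lambda>v. of_real (2 * (t / 2) * weight z powr (t / 2 - 1) * (snd z \<bullet> snd v)))) (at z)" for z :: "'a phase_space"
    by (rule has_derivative_of_real[OF weight_has_derivative])
  have "symbol_order j s (t - r) (dir_deriv v (\<lambda>z. complex_of_real (weight z powr (t / 2))))" for v
  proof -
    have "dir_deriv v (\<lambda>z. complex_of_real (weight z powr (t / 2)))
      = (\<lambda>z. of_real t * (of_real (weight z powr (t/2 - 1)) * of_real (snd z \<bullet> snd v)))"
      by (rule ext) (simp add: dir_deriv_eq[OF d])
    moreover have "symbol_order j s (2 * (t/2 - 1) + 1) \<dots>"
      by (intro symbol_order_cmult symbol_order.mult symbol_order_weight symbol_order.lin)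
    ultimately show ?thesis
      using symbol_order.mono[of j s "2 * (t/2 - 1) + 1" _ "t - r"] r by auto
  qed
  then show ?case using differentiableI[OF d] by blast
next
  case expo
  have "symbol_order j s (0 - r) (dir_deriv v (osc_symbol j s))" for v
  proof -
    have A: "symbol_order j s (s - 1) (\<lambda>z. of_real (coord j v) * of_real (weight z powr ((s - 1) / 2)))"
      by (intro symbol_order_cmult symbol_order.wt)
    have "symbol_order j s (1 + (s - 3)) (\<lambda>z. of_real (coord j z) * of_real (weight z powr ((s - 3) / 2)))"
      unfolding coord_eq by (intro symbol_order.mult symbol_order.lin symbol_order.wt)
    then have "symbol_order j s (1 + (s - 3) + 1) (\<lambda>z. of_real (s - 1) * (of_real (coord j z) * of_real (weight z powr ((s - 3) / 2))) * of_real (snd z \<bullet> snd v))"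
      by (intro symbol_order.mult[OF symbol_order_cmult symbol_order.lin])
    then have B: "symbol_order j s (s - 1) (\<lambda>z. of_real (s - 1) * of_real (coord j z * weight z powr ((s - 3) / 2)) * of_real (snd z \<bullet> snd v))"
      by (simp add: algebra_simps)
    have "symbol_order j s (s - 1 + 0) (\<lambda>z. \<i> * (of_real (coord j v) * of_real (weight z powr ((s - 1) / 2))
        + of_real (s - 1) * of_real (coord j z * weight z powr ((s - 3) / 2)) * of_real (snd z \<bullet> snd v))
       * osc_symbol j s z)"
      by (intro symbol_order.mult[OF _ symbol_order.expo] symbol_order_cmult symbol_order.add A B)
    moreover have "dir_deriv v (osc_symbol j s) = (\<lambda>z. \<i> * (of_real (coord j v) * of_real (weight z powr ((s - 1) / 2))
        + of_real (s - 1) * of_real (coord j z * weight z powr ((s - 3) / 2)) * of_real (snd z \<bullet> snd v))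
       * osc_symbol j s z)"
      using dir_deriv_eq[OF osc_symbol_has_derivative] by blast
    ultimately show ?thesis
      using symbol_order.mono[of j s "s - 1 + 0" _ "0 - r"] r by auto
  qed
  then show ?case using differentiableI[OF osc_symbol_has_derivative] by blast
next
  case (mono m f m')
  then show ?case using symbol_order.mono[of j s "m - r" _ "m' - r"] by auto
next
  case (add m f g)
  have fd: "(f has_derivative frechet_derivative f (at z)) (at z)" for z
    using add by (metis frechet_derivative_works)
  have gd: "(g has_derivative frechet_derivative g (at z)) (at z)" for z
    using add by (metis frechet_derivative_works)
  have d: "((\<lambda>z. f z + g z) has_derivative (\<lambda>v. frechet_derivative f (at z) v + frechet_derivative g (at z) v)) (at z)" for z
    by (intro has_derivative_add fd gd)
  have "dir_deriv v (\<lambda>z. f z + g z) = (\<lambda>z. dir_deriv v f z + dir_deriv v g z)" for v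
    by (rule ext) (simp add: dir_deriv_eq[OF d] dir_deriv_eq[OF fd] dir_deriv_eq[OF gd])
  then show ?case using differentiableI[OF d] add by (simp add: symbol_order.add del: split_paired_All)
next
  case (mult m f m' g)
  have fd: "(f has_derivative frechet_derivative f (at z)) (at z)" for z
    using mult by (metis frechet_derivative_works)
  have gd: "(g has_derivative frechet_derivative g (at z)) (at z)" for z
    using mult by (metis frechet_derivative_works)
  have d: "((\<lambda>z. f z * g z) has_derivative (\<lambda>v. f z * frechet_derivative g (at z) v + frechet_derivative f (at z) v * g z)) (at z)" for z
    by (intro has_derivative_mult fd gd)
  have "symbol_order j s (m + m' - r) (dir_deriv v (\<lambda>z. f z * g z))" for v
  proof -
    have "dir_deriv v (\<lambda>z. f z * g z) = (\<lambda>z. f z * dir_deriv v g z + dir_deriv v f z * g z)"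
      by (rule ext) (simp add: dir_deriv_eq[OF d] dir_deriv_eq[OF fd] dir_deriv_eq[OF gd])
    moreover have "symbol_order j s (m + (m' - r)) (\<lambda>z. f z * dir_deriv v g z)"
      "symbol_order j s ((m - r) + m') (\<lambda>z. dir_deriv v f z * g z)"
      using mult by (blast intro: symbol_order.mult)+
    ultimately show ?thesis by (simp add: symbol_order.add algebra_simps)
  qed
  then show ?case using differentiableI[OF d] by blast
qed

text \<open>
Derivatives in \<open>x\<close> are credited with the same gain as the others. This is harmless, as
they vanish.
\<close>
lemma symbol_order_iterated:
  assumes "symbol_order j s m f" and r: "r \<le> 1" "r \<le> 1 - s"
  shows "symbol_order j s (m - r * length vs) (foldr dir_deriv vs f)"
proof (induction vs)
  case (Cons v vs)
  have "m - r * real (length (v # vs)) = (m - r * real (length vs)) - r"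
    by (simp add: algebra_simps)
  moreover have "symbol_order j s (m - r * real (length vs) - r) (foldr dir_deriv (v # vs) f)"
    using conjunct2[OF symbol_order_dir_deriv[OF Cons r], rule_format, of v] by simp
  ultimately show ?case by metis
qed (use assms in auto)

text \<open>
The gain is \<open>\<rho>\<close> for each letter of a word of derivatives. Turning this into the bound in terms of
\<open>1 + |\<xi>| + |\<eta>|\<close> uses \<open>(1 + |\<xi>| + |\<eta>|)\<^sup>2 \<le> 3 (1 + |\<xi>|\<^sup>2 + |\<eta>|\<^sup>2)\<close>.
\<close>
lemma osc_symbol_in_BS:
  assumes "0 \<le> \<rho>" "\<rho> \<le> 1" "0 \<le> \<delta>" "\<rho> \<le> 1 - s"
  shows "osc_symbol j s \<in> BS 0 \<rho> \<delta>"
proof -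
  have it: "symbol_order j s (0 - \<rho> * length vs) (foldr dir_deriv vs (osc_symbol j s))" for vs
    by (intro symbol_order_iterated symbol_order.expo assms)
  have "smooth (osc_symbol j s)"
    unfolding smooth_def using symbol_order_dir_deriv[OF it] assms by blast
  moreover have "\<exists>C. \<forall>x \<xi> \<eta>.
        norm (multi_deriv (\<lambda>i. (axis i 1, 0, 0)) \<alpha>
               (multi_deriv (\<lambda>i. (0, axis i 1, 0)) \<beta>
                 (multi_deriv (\<lambda>i. (0, 0, axis i 1)) \<gamma> (osc_symbol j s))) (x, \<xi>, \<eta>))
        * (1 + norm \<xi> + norm \<eta>) powr
            (- 0 - \<delta> * real (mi_order \<alpha>) + \<rho> * (real (mi_order \<beta>) + real (mi_order \<gamma>))) \<le> C"
    for \<alpha> \<beta> \<gamma> :: "'a \<Rightarrow> nat"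
  proof -
    obtain us where us: "length us = mi_order \<alpha>"
      "\<And>f::'a phase_space \<Rightarrow> complex. multi_deriv (\<lambda>i. (axis i 1, 0, 0)) \<alpha> f = foldr dir_deriv us f"
      by (rule multi_deriv_word) blast
    obtain vs where vs: "length vs = mi_order \<beta>"
      "\<And>f::'a phase_space \<Rightarrow> complex. multi_deriv (\<lambda>i. (0, axis i 1, 0)) \<beta> f = foldr dir_deriv vs f"
      by (rule multi_deriv_word) blast
    obtain ws where ws: "length ws = mi_order \<gamma>"
      "\<And>f::'a phase_space \<Rightarrow> complex. multi_deriv (\<lambda>i. (0, 0, axis i 1)) \<gamma> f = foldr dir_deriv ws f"
      by (rule multi_deriv_word) blast
    let ?D = "foldr dir_deriv (us @ vs @ ws) (osc_symbol j s)"
    let ?l = "real (mi_order \<beta>) + real (mi_order \<gamma>)"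
    obtain C where C: "\<And>z. norm (?D z) \<le> C * weight z powr ((0 - \<rho> * length (us @ vs @ ws)) / 2)"
      using symbol_order_bounded[OF it] by blast
    have "norm (?D (x, \<xi>, \<eta>)) * (1 + norm \<xi> + norm \<eta>) powr (- 0 - \<delta> * real (mi_order \<alpha>) + \<rho> * ?l)
        \<le> \<bar>C\<bar> * 3 powr (\<rho> * ?l / 2)" for x \<xi> \<eta>
    proof -
      let ?z = "(x, \<xi>, \<eta>)" let ?m = "1 + norm \<xi> + norm \<eta>"
      have w: "1 \<le> weight ?z" by (rule weight_ge_1)
      have "norm (?D ?z) \<le> \<bar>C\<bar> * weight ?z powr ((0 - \<rho> * length (us @ vs @ ws)) / 2)"
        using C[of ?z] by (meson abs_ge_self mult_right_mono order.trans powr_ge_zero)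
      also have "\<dots> \<le> \<bar>C\<bar> * weight ?z powr (- (\<rho> * ?l / 2))"
        using assms w by (intro mult_left_mono powr_mono) (auto simp: us vs ws algebra_simps)
      finally have 1: "norm (?D ?z) \<le> \<bar>C\<bar> * weight ?z powr (- (\<rho> * ?l / 2))" .
      have "?m powr (- 0 - \<delta> * real (mi_order \<alpha>) + \<rho> * ?l) \<le> ?m powr (\<rho> * ?l)"
        using assms by (intro powr_mono) auto
      also have "\<dots> = (?m\<^sup>2) powr (\<rho> * ?l / 2)"
        by (simp add: powr_powr add_pos_nonneg flip: powr_numeral)
      also have "\<dots> \<le> (3 * weight ?z) powr (\<rho> * ?l / 2)"
      proof (intro powr_mono2)
        have "0 \<le> (1 - norm \<xi>)\<^sup>2 + (1 - norm \<eta>)\<^sup>2 + (norm \<xi> - norm \<eta>)\<^sup>2" by simp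
        then show "?m\<^sup>2 \<le> 3 * weight ?z"
          by (simp add: weight_def power2_eq_square algebra_simps)
      qed (use assms in auto)
      also have "\<dots> = 3 powr (\<rho> * ?l / 2) * weight ?z powr (\<rho> * ?l / 2)"
        using w by (simp add: powr_mult)
      finally have 2: "?m powr (- 0 - \<delta> * real (mi_order \<alpha>) + \<rho> * ?l)
        \<le> 3 powr (\<rho> * ?l / 2) * weight ?z powr (\<rho> * ?l / 2)" .
      have "norm (?D ?z) * ?m powr (- 0 - \<delta> * real (mi_order \<alpha>) + \<rho> * ?l)
        \<le> (\<bar>C\<bar> * weight ?z powr (- (\<rho> * ?l / 2))) * (3 powr (\<rho> * ?l / 2) * weight ?z powr (\<rho> * ?l / 2))"
        by (intro mult_mono 1 2) auto
      also have "\<dots> = \<bar>C\<bar> * 3 powr (\<rho> * ?l / 2)"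
        using w by (simp add: powr_minus field_simps)
      finally show ?thesis .
    qed
    then show ?thesis unfolding us(2) vs(2) ws(2) by auto
  qed
  ultimately show ?thesis by (simp add: BS_def)
qed

section \<open>Complex Gaussians as Schwartz functions\<close>

text \<open>
One-dimensional factors \<open>exp (- z x\<^sup>2 / 2 + w x + k)\<close> with complex coefficients: modulations change
\<open>w\<close>, translations change \<open>w\<close> and \<open>k\<close>, and dilations change \<open>z\<close> and \<open>w\<close>.
\<close>
definition gaussian :: "('a::euclidean_space \<Rightarrow> complex) \<Rightarrow> ('a \<Rightarrow> complex) \<Rightarrow> ('a \<Rightarrow> complex) \<Rightarrow> 'a \<Rightarrow> complex" where
  "gaussian z w k x = (\<Prod>b\<in>Basis. exp (- z b * of_real ((x \<bullet> b)\<^sup>2) / 2 + w b * of_real (x \<bullet> b) + k b))"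

text \<open>
Polynomial multiples of one Gaussian: derivatives stay in this class, and so do products with
coordinates, which is all that membership in the Schwartz class asks for.
\<close>
inductive polygauss :: "('a::euclidean_space \<Rightarrow> complex) \<Rightarrow> ('a \<Rightarrow> complex) \<Rightarrow> ('a \<Rightarrow> complex) \<Rightarrow> ('a \<Rightarrow> complex) \<Rightarrow> bool"
  for z w k where
  base: "polygauss z w k (gaussian z w k)"
| coord_mult: "polygauss z w k f \<Longrightarrow> polygauss z w k (\<lambda>x. of_real (x \<bullet> b) * f x)"
| scale: "polygauss z w k f \<Longrightarrow> polygauss z w k (\<lambda>x. c * f x)"
| add: "polygauss z w k f \<Longrightarrow> polygauss z w k g \<Longrightarrow> polygauss z w k (\<lambda>x. f x + g x)"

lemma gaussian_eq_exp:
  "gaussian z w k x = exp (\<Sum>b\<in>Basis. - z b * of_real ((x \<bullet> b)\<^sup>2) / 2 + w b * of_real (x \<bullet> b) + k b)"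
  by (simp add: gaussian_def exp_sum)

lemma gaussian_has_derivative:
  "(gaussian z w k has_derivative
     (\<lambda>v. gaussian z w k x * (\<Sum>b\<in>Basis. of_real (v \<bullet> b) * (w b - z b * of_real (x \<bullet> b))))) (at x)"
proof -
  have "((\<lambda>x. \<Sum>b\<in>Basis. - z b * of_real ((x \<bullet> b)\<^sup>2) / 2 + w b * of_real (x \<bullet> b) + k b) has_derivative
      (\<lambda>v. \<Sum>b\<in>Basis. of_real (v \<bullet> b) * (w b - z b * of_real (x \<bullet> b)))) (at x)"
    by (auto intro!: derivative_eq_intros sum.cong simp: fun_eq_iff algebra_simps)
  from has_derivative_compose[OF this has_field_derivative_imp_has_derivative[OF DERIV_exp]]
  show ?thesis unfolding gaussian_eq_exp[abs_def] .
qed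

lemma polygauss_sum:
  assumes "finite I" "I \<noteq> {}" "\<And>i. i \<in> I \<Longrightarrow> polygauss z w k (f i)"
  shows "polygauss z w k (\<lambda>x. \<Sum>i\<in>I. f i x)"
  using assms
proof (induction rule: finite_ne_induct)
  case (insert i I)
  then show ?case by (auto intro!: polygauss.add)
qed auto

lemma polygauss_dir_deriv:
  assumes "polygauss z w k f"
  shows "(\<forall>x. f differentiable at x) \<and> (\<forall>v. polygauss z w k (dir_deriv v f))"
  using assms
proof induction
  case base
  have "polygauss z w k (dir_deriv v (gaussian z w k))" for v
  proof -
    have "dir_deriv v (gaussian z w k) = (\<lambda>x. \<Sum>b\<in>Basis.
        of_real (v \<bullet> b) * w b * gaussian z w k x + (- of_real (v \<bullet> b) * z b) * (of_real (x \<bullet> b) * gaussian z w k x))"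
      by (simp add: fun_eq_iff dir_deriv_eq[OF gaussian_has_derivative] sum_distrib_left algebra_simps)
    moreover have "polygauss z w k \<dots>"
      by (intro polygauss_sum polygauss.add polygauss.scale polygauss.coord_mult polygauss.base) auto
    ultimately show ?thesis by metis
  qed
  then show ?case using differentiableI[OF gaussian_has_derivative] by blast
next
  case (coord_mult f b)
  have fd: "(f has_derivative frechet_derivative f (at x)) (at x)" for x
    using coord_mult by (metis frechet_derivative_works)
  have d: "((\<lambda>x. of_real (x \<bullet> b) * f x) has_derivative
      (\<lambda>v. of_real (x \<bullet> b) * frechet_derivative f (at x) v + of_real (v \<bullet> b) * f x)) (at x)" for x
    by (intro has_derivative_mult has_derivative_of_real has_derivative_inner_left has_derivative_ident fd)
  have "polygauss z w k (dir_deriv v (\<lambda>x. of_real (x \<bullet> b) * f x))" for v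
  proof -
    have "dir_deriv v (\<lambda>x. of_real (x \<bullet> b) * f x)
      = (\<lambda>x. of_real (x \<bullet> b) * dir_deriv v f x + of_real (v \<bullet> b) * f x)"
      by (rule ext) (simp add: dir_deriv_eq[OF d] dir_deriv_eq[OF fd])
    with coord_mult show ?thesis by (auto intro!: polygauss.add polygauss.scale polygauss.coord_mult)
  qed
  then show ?case using differentiableI[OF d] by blast
next
  case (scale f c)
  have fd: "(f has_derivative frechet_derivative f (at x)) (at x)" for x
    using scale by (metis frechet_derivative_works)
  have d: "((\<lambda>x. c * f x) has_derivative (\<lambda>v. c * frechet_derivative f (at x) v)) (at x)" for x
    by (intro has_derivative_mult_right fd)
  have "dir_deriv v (\<lambda>x. c * f x) = (\<lambda>x. c * dir_deriv v f x)" for v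
    by (rule ext) (simp add: dir_deriv_eq[OF d] dir_deriv_eq[OF fd])
  then show ?case using differentiableI[OF d] scale by (simp add: polygauss.scale)
next
  case (add f g)
  have fd: "(f has_derivative frechet_derivative f (at x)) (at x)" for x
    using add by (metis frechet_derivative_works)
  have gd: "(g has_derivative frechet_derivative g (at x)) (at x)" for x
    using add by (metis frechet_derivative_works)
  have d: "((\<lambda>x. f x + g x) has_derivative
      (\<lambda>v. frechet_derivative f (at x) v + frechet_derivative g (at x) v)) (at x)" for x
    by (intro has_derivative_add fd gd)
  have "dir_deriv v (\<lambda>x. f x + g x) = (\<lambda>x. dir_deriv v f x + dir_deriv v g x)" for v
    by (rule ext) (simp add: dir_deriv_eq[OF d] dir_deriv_eq[OF fd] dir_deriv_eq[OF gd])
  then show ?case using differentiableI[OF d] add by (simp add: polygauss.add)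
qed

lemma norm_gaussian:
  "norm (gaussian z w k x) = (\<Prod>b\<in>Basis. exp (- Re (z b) * (x \<bullet> b)\<^sup>2 / 2 + Re (w b) * (x \<bullet> b) + Re (k b)))"
  by (simp add: gaussian_def prod_norm[symmetric] flip: of_real_power)

text \<open>
Completing the square absorbs both the linear part of the exponent and the polynomial factor,
which is bounded by \<open>m! exp (1 + |x|)\<close>.
\<close>
lemma gaussian_decay:
  fixes z :: "'a::euclidean_space \<Rightarrow> complex"
  assumes z: "\<And>b. b \<in> Basis \<Longrightarrow> 0 < Re (z b)"
  shows "\<exists>C. \<forall>x. (1 + norm x) ^ m * norm (gaussian z w k x) \<le> C"
proof -
  define a where "a = Min ((\<lambda>b. Re (z b)) ` Basis)"
  have a0: "0 < a" and a: "\<And>b. b \<in> Basis \<Longrightarrow> a \<le> Re (z b)"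
    using z unfolding a_def by auto
  define R where "R = (\<Sum>b\<in>Basis. \<bar>Re (w b)\<bar>)"
  define S where "S = (\<Sum>b\<in>Basis. Re (k b))"
  have "(1 + norm x) ^ m * norm (gaussian z w k x) \<le> fact m * exp (1 + S + (1 + R)\<^sup>2 / (2 * a))" for x :: 'a
  proof -
    have "(\<Sum>b\<in>Basis. - Re (z b) * (x \<bullet> b)\<^sup>2 / 2 + Re (w b) * (x \<bullet> b) + Re (k b))
        \<le> (\<Sum>b\<in>Basis. - (a / 2) * (x \<bullet> b)\<^sup>2 + \<bar>Re (w b)\<bar> * norm x + Re (k b))"
    proof (intro sum_mono add_mono order.refl)
      fix b :: 'a assume b: "b \<in> Basis"
      show "- Re (z b) * (x \<bullet> b)\<^sup>2 / 2 \<le> - (a / 2) * (x \<bullet> b)\<^sup>2"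
        using mult_right_mono[OF a[OF b], of "(x \<bullet> b)\<^sup>2"] by simp
      have "Re (w b) * (x \<bullet> b) \<le> \<bar>Re (w b)\<bar> * \<bar>x \<bullet> b\<bar>"
        by (metis abs_ge_self abs_mult)
      also have "\<dots> \<le> \<bar>Re (w b)\<bar> * norm x"
        using Basis_le_norm[OF b, of x] by (intro mult_left_mono) auto
      finally show "Re (w b) * (x \<bullet> b) \<le> \<bar>Re (w b)\<bar> * norm x" .
    qed
    also have "\<dots> = - (a / 2) * (norm x)\<^sup>2 + R * norm x + S"
      unfolding R_def S_def dot_square_norm[symmetric] euclidean_inner[of x x]
      by (simp only: sum.distrib sum_distrib_left sum_distrib_right power2_eq_square)
    finally have 1: "norm (gaussian z w k x) \<le> exp (- (a / 2) * (norm x)\<^sup>2 + R * norm x + S)"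
      by (simp add: norm_gaussian flip: exp_sum)
    have "(1 + norm x) ^ m / fact m \<le> exp (1 + norm x)"
    proof -
      have "(1 + norm x) ^ m / fact m = (\<Sum>n\<in>{m}. (1 + norm x) ^ n /\<^sub>R fact n)"
        by (simp add: field_simps)
      also have "\<dots> \<le> (\<Sum>n. (1 + norm x) ^ n /\<^sub>R fact n)"
        by (intro sum_le_suminf summable_exp_generic) auto
      finally show ?thesis by (simp add: exp_def)
    qed
    then have 2: "(1 + norm x) ^ m \<le> fact m * exp (1 + norm x)" by (simp add: field_simps)
    have "(1 + norm x) ^ m * norm (gaussian z w k x)
      \<le> (fact m * exp (1 + norm x)) * exp (- (a / 2) * (norm x)\<^sup>2 + R * norm x + S)"
      by (intro mult_mono 1 2) auto
    also have "\<dots> = fact m * exp (1 + norm x + (- (a / 2) * (norm x)\<^sup>2 + R * norm x + S))"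
      by (simp add: exp_add)
    also have "1 + norm x + (- (a / 2) * (norm x)\<^sup>2 + R * norm x + S) \<le> 1 + S + (1 + R)\<^sup>2 / (2 * a)"
    proof -
      have "0 \<le> (a * norm x - (1 + R))\<^sup>2 / (2 * a)" using a0 by simp
      also have "\<dots> = (a / 2) * (norm x)\<^sup>2 - (1 + R) * norm x + (1 + R)\<^sup>2 / (2 * a)"
        using a0 by (simp add: field_simps power2_eq_square)
      finally show ?thesis by (simp add: algebra_simps)
    qed
    finally show ?thesis by simp
  qed
  then show ?thesis by blast
qed

lemma polygauss_decay:
  fixes z :: "'a::euclidean_space \<Rightarrow> complex"
  assumes "polygauss z w k f" and z: "\<And>b. b \<in> Basis \<Longrightarrow> 0 < Re (z b)"
  shows "\<exists>C. \<forall>x. (1 + norm x) ^ m * norm (f x) \<le> C"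
  using assms(1)
proof (induction arbitrary: m)
  case base
  then show ?case by (rule gaussian_decay[OF z])
next
  case (coord_mult f b)
  obtain C where C: "\<And>x. (1 + norm x) ^ Suc m * norm (f x) \<le> C"
    using coord_mult.IH by blast
  have "(1 + norm x) ^ m * norm (of_real (x \<bullet> b) * f x) \<le> norm b * C" for x
  proof -
    have "\<bar>x \<bullet> b\<bar> \<le> norm b * (1 + norm x)"
      using Cauchy_Schwarz_ineq2[of x b] by (simp add: algebra_simps) (smt (verit) norm_ge_zero)
    then have "(1 + norm x) ^ m * norm (of_real (x \<bullet> b) * f x)
      \<le> (1 + norm x) ^ m * ((norm b * (1 + norm x)) * norm (f x))"
      by (intro mult_left_mono) (auto simp: norm_mult intro!: mult_right_mono)
    also have "\<dots> = norm b * ((1 + norm x) ^ Suc m * norm (f x))" by simp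
    also have "\<dots> \<le> norm b * C" by (intro mult_left_mono C) auto
    finally show ?thesis .
  qed
  then show ?case by blast
next
  case (scale f c)
  obtain C where C: "\<And>x. (1 + norm x) ^ m * norm (f x) \<le> C"
    using scale.IH by blast
  have "(1 + norm x) ^ m * norm (c * f x) \<le> norm c * C" for x
    using mult_left_mono[OF C[of x], of "norm c"] by (simp add: norm_mult mult_ac)
  then show ?case by blast
next
  case (add f g)
  obtain C D where C: "\<And>x. (1 + norm x) ^ m * norm (f x) \<le> C"
    and D: "\<And>x. (1 + norm x) ^ m * norm (g x) \<le> D"
    using add.IH by metis
  have "(1 + norm x) ^ m * norm (f x + g x) \<le> C + D" for x
  proof -
    have "(1 + norm x) ^ m * norm (f x + g x) \<le> (1 + norm x) ^ m * (norm (f x) + norm (g x))"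
      by (intro mult_left_mono norm_triangle_ineq) auto
    with C[of x] D[of x] show ?thesis by (simp add: distrib_left)
  qed
  then show ?case by blast
qed

lemma gaussian_in_schwartz:
  assumes "\<And>b. b \<in> Basis \<Longrightarrow> 0 < Re (z b)"
  shows "gaussian z w k \<in> schwartz"
proof -
  have it: "polygauss z w k (foldr dir_deriv vs (gaussian z w k))" for vs
    by (induction vs) (auto intro: polygauss.base simp: polygauss_dir_deriv)
  have "\<exists>C. \<forall>x. norm (of_real (\<Prod>i\<in>UNIV. x $ i ^ \<alpha> i) * multi_deriv (\<lambda>i. axis i 1) \<beta> (gaussian z w k) x) \<le> C"
    for \<alpha> \<beta> :: "'a \<Rightarrow> nat"
  proof -
    obtain vs where vs: "\<And>f::(real^'a) \<Rightarrow> complex. multi_deriv (\<lambda>i. axis i 1) \<beta> f = foldr dir_deriv vs f"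
      by (rule multi_deriv_word) blast
    obtain C where C: "\<And>x. (1 + norm x) ^ mi_order \<alpha> * norm (foldr dir_deriv vs (gaussian z w k) x) \<le> C"
      using polygauss_decay[OF it assms] by blast
    have "norm (of_real (\<Prod>i\<in>UNIV. x $ i ^ \<alpha> i) * foldr dir_deriv vs (gaussian z w k) x) \<le> C" for x :: "real ^ 'a"
    proof -
      have "\<bar>x $ i\<bar> \<le> 1 + norm x" for i
        using component_le_norm_cart[of x i] by simp
      then have "(\<Prod>i\<in>UNIV. \<bar>x $ i\<bar> ^ \<alpha> i) \<le> (\<Prod>i\<in>UNIV. (1 + norm x) ^ \<alpha> i)"
        by (intro prod_mono conjI power_mono) auto
      also have "\<dots> = (1 + norm x) ^ mi_order \<alpha>" by (simp add: mi_order_def power_sum)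
      finally have "norm (complex_of_real (\<Prod>i\<in>UNIV. x $ i ^ \<alpha> i)) \<le> (1 + norm x) ^ mi_order \<alpha>"
        by (simp add: abs_prod power_abs del: of_real_prod)
      then show ?thesis
        unfolding norm_mult using C[of x] by (meson mult_right_mono norm_ge_zero order.trans)
    qed
    then show ?thesis unfolding vs by blast
  qed
  moreover have "smooth (gaussian z w k)"
    unfolding smooth_def using polygauss_dir_deriv[OF it] by blast
  ultimately show ?thesis by (simp add: schwartz_def)
qed

text \<open>
The test functions of the blow-up argument are Gaussians again, hence Schwartz functions.
\<close>
lemma gaussian_affine:
  fixes z :: "'a::euclidean_space \<Rightarrow> complex"
  shows "(\<lambda>x. exp (\<i> * of_real (a \<bullet> x)) * gaussian z (\<lambda>_. 0) (\<lambda>_. 0) (L *\<^sub>R (x - y)))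
    = gaussian (\<lambda>b. of_real (L\<^sup>2) * z b) (\<lambda>b. of_real (L\<^sup>2 * (y \<bullet> b)) * z b + \<i> * of_real (a \<bullet> b))
        (\<lambda>b. - z b * of_real (L\<^sup>2 * (y \<bullet> b)\<^sup>2) / 2)"
proof
  fix x
  show "exp (\<i> * of_real (a \<bullet> x)) * gaussian z (\<lambda>_. 0) (\<lambda>_. 0) (L *\<^sub>R (x - y))
    = gaussian (\<lambda>b. of_real (L\<^sup>2) * z b) (\<lambda>b. of_real (L\<^sup>2 * (y \<bullet> b)) * z b + \<i> * of_real (a \<bullet> b))
        (\<lambda>b. - z b * of_real (L\<^sup>2 * (y \<bullet> b)\<^sup>2) / 2) x"
    unfolding gaussian_eq_exp euclidean_inner[of a x] exp_add[symmetric] of_real_sum sum_distrib_left sum.distrib[symmetric]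
    by (intro arg_cong[of _ _ exp] sum.cong refl) (simp add: inner_diff_left power2_eq_square field_simps)
qed

section \<open>Complex Gaussian integrals\<close>

lemma tendsto_integral_symmetric_interval:
  fixes f :: "real \<Rightarrow> 'a::{banach, second_countable_topology}"
  assumes f: "integrable lborel f"
  shows "((\<lambda>R. \<integral>x. indicator {-R..R} x *\<^sub>R f x \<partial>lborel) \<longlongrightarrow> (\<integral>x. f x \<partial>lborel)) at_top"
proof (rule tendsto_at_topI_sequentially)
  fix X :: "nat \<Rightarrow> real" assume X: "filterlim X at_top sequentially"
  have [measurable]: "f \<in> borel_measurable borel" using f by auto
  show "(\<lambda>n. \<integral>x. indicator {-X n..X n} x *\<^sub>R f x \<partial>lborel) \<longlonglongrightarrow> (\<integral>x. f x \<partial>lborel)"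
  proof (rule integral_dominated_convergence)
    show "integrable lborel (\<lambda>x. norm (f x))" using f by auto
    show "AE x in lborel. (\<lambda>n. indicator {-X n..X n} x *\<^sub>R f x) \<longlonglongrightarrow> f x"
    proof (rule AE_I2)
      fix x :: real
      have "eventually (\<lambda>n. \<bar>x\<bar> \<le> X n) sequentially"
        using X by (auto simp: filterlim_at_top)
      then show "(\<lambda>n. indicator {-X n..X n} x *\<^sub>R f x) \<longlonglongrightarrow> f x"
        by (intro tendsto_eventually) (rule eventually_mono, assumption, auto simp: indicator_def abs_le_iff)
    qed
  qed (auto split: split_indicator)
qed

lemma std_gaussian_integral:
  "has_bochner_integral lborel (\<lambda>x::real. complex_of_real (exp (- x\<^sup>2 / 2))) (of_real (sqrt (2 * pi)))"
proof -
  have "has_bochner_integral lborel (\<lambda>x. exp (- x\<^sup>2 / 2)) (sqrt (2 * pi))"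
  proof -
    have "has_bochner_integral lborel (\<lambda>x. sqrt (2 * pi) * std_normal_density x) (sqrt (2 * pi) * 1)"
      using integral_normal_density[of 1 0] integrable_normal_density[of 1 0]
      by (intro has_bochner_integral_mult_right) (auto simp: has_bochner_integral_iff)
    then show ?thesis by (simp add: std_normal_density_def)
  qed
  then show ?thesis by (rule has_bochner_integral_of_real)
qed

lemma real_gaussian_integral:
  fixes a :: real
  assumes "0 < a"
  shows "has_bochner_integral lborel (\<lambda>x::real. exp (- a * x\<^sup>2)) (sqrt (pi / a))"
proof -
  let ?\<sigma> = "sqrt (1 / (2 * a))"
  have "normal_density 0 ?\<sigma> = (\<lambda>x. sqrt (a / pi) * exp (- a * x\<^sup>2))"
    using assms by (simp add: fun_eq_iff normal_density_def real_sqrt_divide field_simps)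
  moreover have "has_bochner_integral lborel (normal_density 0 ?\<sigma>) 1"
    using integral_normal_density[of ?\<sigma> 0] integrable_normal_density[of ?\<sigma> 0] assms
    by (simp add: has_bochner_integral_iff)
  ultimately have "has_bochner_integral lborel (\<lambda>x. sqrt (a / pi) * exp (- a * x\<^sup>2)) 1"
    by metis
  then have "has_bochner_integral lborel (\<lambda>x. sqrt (pi / a) * (sqrt (a / pi) * exp (- a * x\<^sup>2))) (sqrt (pi / a) * 1)"
    by (rule has_bochner_integral_mult_right)
  moreover have "sqrt (pi / a) * sqrt (a / pi) = 1"
    using assms by (simp flip: real_sqrt_mult)
  ultimately show ?thesis by (simp flip: mult.assoc)
qed

text \<open>
Half of the decay of \<open>exp (- Re z x\<^sup>2 / 2)\<close> is spent on the linear term.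
\<close>
lemma integrable_complex_gaussian:
  assumes "0 < Re z"
  shows "integrable lborel (\<lambda>x::real. exp (- z * of_real (x\<^sup>2) / 2 + w * of_real x))"
proof (rule Bochner_Integration.integrable_bound)
  let ?a = "Re z / 4"
  show "integrable lborel (\<lambda>x::real. exp ((Re w)\<^sup>2 / Re z) * exp (- ?a * x\<^sup>2))"
    using real_gaussian_integral[of ?a] assms by (auto simp: has_bochner_integral_iff)
  show "AE x in lborel. norm (exp (- z * of_real (x\<^sup>2) / 2 + w * of_real x)) \<le> norm (exp ((Re w)\<^sup>2 / Re z) * exp (- ?a * x\<^sup>2))"
  proof (rule AE_I2)
    fix x :: real
    have "0 \<le> (Re z * x / 2 - Re w)\<^sup>2 / Re z" using assms by simp
    also have "\<dots> = Re z * x\<^sup>2 / 4 - Re w * x + (Re w)\<^sup>2 / Re z"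
      using assms by (simp add: field_simps power2_eq_square)
    finally show "norm (exp (- z * of_real (x\<^sup>2) / 2 + w * of_real x)) \<le> norm (exp ((Re w)\<^sup>2 / Re z) * exp (- ?a * x\<^sup>2))"
      by (simp add: norm_exp flip: exp_add of_real_power)
  qed
qed simp

text \<open>
Up to a change of variables this is the integral of the entire function \<open>exp (- y\<^sup>2 / 2)\<close> along the
line \<open>\<alpha> + \<beta> \<real>\<close>. By means of a primitive \<open>H\<close> it reduces to values of \<open>H\<close> at the two end points,
and these may be moved to \<open>R\<close> and \<open>-R\<close>: on the segments in between, which stay in the sector
\<open>|Im y| < Re y\<close> or its negative up to a bounded shift, the integrand decays like a Gaussian.
\<close>
lemma rotated_gaussian_integral:
  fixes \<alpha> \<beta> :: complex
  assumes \<beta>: "\<bar>Im \<beta>\<bar> < Re \<beta>"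
  shows "((\<lambda>R. \<integral>x. indicator {-R..R} x *\<^sub>R (\<beta> * exp (- (\<alpha> + \<beta> * of_real x)\<^sup>2 / 2)) \<partial>lborel)
    \<longlongrightarrow> of_real (sqrt (2 * pi))) at_top"
proof -
  define h :: "complex \<Rightarrow> complex" where "h y = exp (- y\<^sup>2 / 2)" for y
  obtain H where H: "\<And>y. (H has_field_derivative h y) (at y)"
  proof -
    have "h holomorphic_on UNIV" unfolding h_def by (intro holomorphic_intros) auto
    from holomorphic_convex_primitive'[OF convex_UNIV open_UNIV this] show ?thesis
      using that by auto
  qed
  have ftc: "(\<integral>x. indicator {-R..R} x *\<^sub>R (b * h (a + b * of_real x)) \<partial>lborel) = H (a + b * R) - H (a - b * R)"
    if "0 \<le> R" for R :: real and a b
  proof -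
    have "has_bochner_integral lborel (\<lambda>x. indicator {-R..R} x *\<^sub>R (b * h (a + b * of_real x)))
        (H (a + b * of_real R) - H (a + b * of_real (-R)))"
    proof (rule has_bochner_integral_FTC_Icc)
      fix x :: real
      show "((\<lambda>x. H (a + b * of_real x)) has_vector_derivative b * h (a + b * of_real x)) (at x within {-R..R})"
        by (rule has_vector_derivative_at_within, rule has_vector_derivative_eq_rhs,
            rule field_vector_diff_chain_at[unfolded o_def, OF _ H])
           (auto intro!: derivative_eq_intros)
      show "continuous_on {-R..R} (\<lambda>x. b * h (a + b * of_real x))"
        unfolding h_def by (intro continuous_intros) auto
    qed (use that in auto)
    then show ?thesis by (simp add: has_bochner_integral_iff)
  qed
  \<comment> \<open>\<open>H\<close> has the same limit at infinity along each line with a direction in the sector.\<close>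
  have ends: "((\<lambda>R::real. H (a + b * of_real R) - H (of_real R)) \<longlongrightarrow> 0) at_top" 
    if b: "\<bar>Im b\<bar> < Re b" for a b
  proof -
    \<comment> \<open>\<open>c\<close> bounds \<open>Re (q\<^sup>2)\<close> from below for \<open>q\<close> between \<open>1\<close> and \<open>b\<close>; the \<open>1 / 2\<close> is the minimum of \<open>(1 - t)\<^sup>2 + t\<^sup>2\<close>.\<close>
    define c where "c = min 1 ((Re b)\<^sup>2 - (Im b)\<^sup>2) / 2"
    have c0: "0 < c" using b abs_square_less_1 power_strict_mono[OF b, of 2] unfolding c_def by auto
    define d where "d = norm (b - 1)"
    define M where "M = (1 + norm b) * norm a"
    have bound: "norm (H (a + b * of_real R) - H (of_real R))
      \<le> exp ((- c * R\<^sup>2 + 2 * M * R + (norm a)\<^sup>2) / 2) * (norm a + d * R)" if R: "0 \<le> R" for R :: real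
    proof -
      have "norm (H (a + b * of_real R) - H (of_real R))
        \<le> exp ((- c * R\<^sup>2 + 2 * M * R + (norm a)\<^sup>2) / 2) * norm ((a + b * of_real R) - of_real R)"
      proof (rule field_differentiable_bound[of "closed_segment (of_real R) (a + b * of_real R)" H h])
        fix y assume "y \<in> closed_segment (complex_of_real R) (a + b * of_real R)"
        then obtain t where t: "0 \<le> t" "t \<le> 1" and y: "y = (1 - t) *\<^sub>R of_real R + t *\<^sub>R (a + b * of_real R)"
          by (auto simp: closed_segment_def)
        define q where "q = (1 - t) + t * b"
        have y': "y = q * of_real R + of_real t * a"
          by (simp add: y q_def scaleR_conv_of_real algebra_simps)
        have "c \<le> Re (q\<^sup>2)"
        proof -
          have "c \<le> min 1 ((Re b)\<^sup>2 - (Im b)\<^sup>2) * ((1 - t)\<^sup>2 + t\<^sup>2)"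
          proof -
            have "0 \<le> (1 - 2 * t)\<^sup>2" by simp
            then have "1 / 2 \<le> (1 - t)\<^sup>2 + t\<^sup>2" by (simp add: power2_eq_square algebra_simps)
            from mult_left_mono[OF this, of "min 1 ((Re b)\<^sup>2 - (Im b)\<^sup>2)"] c0 show ?thesis
              by (simp add: c_def)
          qed
          also have "\<dots> \<le> 1 * (1 - t)\<^sup>2 + ((Re b)\<^sup>2 - (Im b)\<^sup>2) * t\<^sup>2"
            unfolding distrib_left by (intro add_mono mult_right_mono) auto
          also have "\<dots> \<le> Re (q\<^sup>2)"
          proof -
            have "0 \<le> 2 * t * (1 - t) * Re b" using t b by (intro mult_nonneg_nonneg) auto
            moreover have "Re (q\<^sup>2) = 1 * (1 - t)\<^sup>2 + ((Re b)\<^sup>2 - (Im b)\<^sup>2) * t\<^sup>2 + 2 * t * (1 - t) * Re b"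
              by (simp add: q_def power2_eq_square algebra_simps)
            ultimately show ?thesis by linarith
          qed
          finally show ?thesis .
        qed
        have q1: "norm q \<le> 1 + norm b"
        proof -
          have "norm q \<le> (1 - t) + t * norm b"
            unfolding q_def using t by (metis abs_of_nonneg diff_ge_0_iff_ge norm_mult norm_of_real norm_triangle_le of_real_1 of_real_diff order.refl add_mono)
          also have "\<dots> \<le> 1 + norm b" using t by (intro add_mono) (auto intro: mult_left_le_one_le)
          finally show ?thesis .
        qed
        have "Re (y\<^sup>2) = Re (q\<^sup>2) * R\<^sup>2 + Re (2 * q * a * of_real (t * R)) + Re (of_real (t\<^sup>2) * a\<^sup>2)"
          by (simp add: y' power2_eq_square algebra_simps)
        moreover have "c * R\<^sup>2 \<le> Re (q\<^sup>2) * R\<^sup>2" using \<open>c \<le> Re (q\<^sup>2)\<close> by (intro mult_right_mono) auto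
        moreover have "- (2 * M * R) \<le> Re (2 * q * a * of_real (t * R))"
        proof -
          have "norm (2 * q * a * of_real (t * R)) = 2 * (norm q * norm a) * (t * R)"
            using t R by (simp add: norm_mult)
          also have "\<dots> \<le> 2 * ((1 + norm b) * norm a) * (1 * R)"
            using t R q1 by (intro mult_mono) auto
          finally have "norm (2 * q * a * of_real (t * R)) \<le> 2 * M * R" by (simp add: M_def)
          then show ?thesis using abs_Re_le_cmod[of "2 * q * a * of_real (t * R)"] by linarith
        qed
        moreover have "- (norm a)\<^sup>2 \<le> Re (of_real (t\<^sup>2) * a\<^sup>2)"
        proof -
          have "norm (of_real (t\<^sup>2) * a\<^sup>2) = t\<^sup>2 * (norm a)\<^sup>2" by (simp add: norm_mult norm_power)
          also have "\<dots> \<le> (norm a)\<^sup>2" using t by (intro mult_left_le_one_le) (auto simp: power_le_one)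
          finally show ?thesis using abs_Re_le_cmod[of "of_real (t\<^sup>2) * a\<^sup>2"] by linarith
        qed
        ultimately have "- Re (y\<^sup>2) \<le> - c * R\<^sup>2 + 2 * M * R + (norm a)\<^sup>2" by linarith
        then show "norm (h y) \<le> exp ((- c * R\<^sup>2 + 2 * M * R + (norm a)\<^sup>2) / 2)"
          by (simp add: h_def norm_exp)
      qed (auto intro: has_field_derivative_at_within H)
      also have "\<dots> \<le> exp ((- c * R\<^sup>2 + 2 * M * R + (norm a)\<^sup>2) / 2) * (norm a + d * R)"
      proof (intro mult_left_mono)
        have "norm (a + b * of_real R - of_real R) = norm (a + (b - 1) * of_real R)" by (simp add: algebra_simps)
        also have "\<dots> \<le> norm a + d * R"
          using R norm_triangle_ineq[of a "(b - 1) * of_real R"] by (simp add: d_def norm_mult)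
        finally show "norm (a + b * of_real R - of_real R) \<le> norm a + d * R" .
      qed simp
      finally show ?thesis .
    qed
    have "((\<lambda>R. exp ((- c * R\<^sup>2 + 2 * M * R + (norm a)\<^sup>2) / 2) * (norm a + d * R)) \<longlongrightarrow> 0) at_top"
      using c0 by real_asymp
    moreover have "\<forall>\<^sub>F R in at_top. norm (H (a + b * of_real R) - H (of_real R))
      \<le> exp ((- c * R\<^sup>2 + 2 * M * R + (norm a)\<^sup>2) / 2) * (norm a + d * R)"
      using eventually_ge_at_top[of 0] by eventually_elim (rule bound)
    ultimately show ?thesis by (rule Lim_null_comparison[rotated])
  qed
  \<comment> \<open>Symmetry reduces the end point at minus infinity to the one at infinity.\<close>
  have neg: "H (- y) = 2 * H 0 - H y" for y
  proof -
    have "((\<lambda>y. H (- y) + H y) has_field_derivative 0) (at y)" for y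
    proof -
      have "((\<lambda>y. H (- y)) has_field_derivative h (- y) * (- 1)) (at y)"
        by (rule DERIV_chain2[OF H]) (auto intro!: derivative_eq_intros)
      from DERIV_add[OF this H[of y]] show ?thesis by (simp add: h_def)
    qed
    then obtain c where "\<And>y. H (- y) + H y = c"
      using has_field_derivative_zero_constant[of UNIV "\<lambda>y. H (- y) + H y"] by auto
    from this[of y] this[of 0] have "H (- y) + H y = H (- 0) + H 0" by simp
    then show ?thesis by (simp add: algebra_simps)
  qed
  have conv: "((\<lambda>R. \<integral>x. indicator {-R..R} x *\<^sub>R (complex_of_real (exp (- x\<^sup>2 / 2))) \<partial>lborel)
      \<longlongrightarrow> of_real (sqrt (2 * pi))) at_top"
    using tendsto_integral_symmetric_interval[of "\<lambda>x. complex_of_real (exp (- x\<^sup>2 / 2))"] std_gaussian_integral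
    by (simp add: has_bochner_integral_iff)
  have "((\<lambda>R. (H (\<alpha> + \<beta> * of_real R) - H (of_real R)) + (H (- \<alpha> + \<beta> * of_real R) - H (of_real R))
      + (\<integral>x. indicator {-R..R} x *\<^sub>R (complex_of_real (exp (- x\<^sup>2 / 2))) \<partial>lborel))
      \<longlongrightarrow> 0 + 0 + of_real (sqrt (2 * pi))) at_top"
    by (intro tendsto_add ends conv \<beta>)
  moreover have "\<forall>\<^sub>F R in at_top. (H (\<alpha> + \<beta> * of_real R) - H (of_real R)) + (H (- \<alpha> + \<beta> * of_real R) - H (of_real R))
      + (\<integral>x. indicator {-R..R} x *\<^sub>R (complex_of_real (exp (- x\<^sup>2 / 2))) \<partial>lborel)
    = (\<integral>x. indicator {-R..R} x *\<^sub>R (\<beta> * exp (- (\<alpha> + \<beta> * of_real x)\<^sup>2 / 2)) \<partial>lborel)"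
    using eventually_ge_at_top[of 0]
  proof eventually_elim
    case (elim R)
    have "(\<integral>x. indicator {-R..R} x *\<^sub>R (complex_of_real (exp (- x\<^sup>2 / 2))) \<partial>lborel) = H R - H (- R)"
      using ftc[OF elim, where a=0 and b=1] by (simp add: h_def exp_of_real[symmetric])
    moreover have "H (\<alpha> - \<beta> * of_real R) = 2 * H 0 - H (- \<alpha> + \<beta> * of_real R)"
      using neg[of "- \<alpha> + \<beta> * of_real R"] by simp
    ultimately show ?case
      using ftc[OF elim, where a=\<alpha> and b=\<beta>] neg[of R] by (simp add: h_def)
  qed
  ultimately show ?thesis by (simp add: tendsto_cong)
qed

text \<open>
The value of the integral of \<open>exp (- z x\<^sup>2 / 2)\<close>, with the branch of the root that is
positive for positive \<open>z\<close>.
\<close>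
definition gauss_const :: "complex \<Rightarrow> complex" where
  "gauss_const z = of_real (sqrt (2 * pi)) / csqrt z"

lemma norm_gauss_const: "norm (gauss_const z) = sqrt (2 * pi / norm z)"
  by (simp add: gauss_const_def norm_divide real_sqrt_divide)

text \<open>
Completing the square with \<open>\<beta> = csqrt z\<close>: the condition \<open>0 < Re z\<close> says exactly that the line of
integration has a direction in the sector \<open>|Im \<beta>| < Re \<beta>\<close>.
\<close>
lemma complex_gaussian_integral:
  assumes z: "0 < Re z"
  shows "has_bochner_integral lborel (\<lambda>x::real. exp (- z * of_real (x\<^sup>2) / 2 + w * of_real x))
    (gauss_const z * exp (w\<^sup>2 / (2 * z)))"
proof -
  define \<beta> where "\<beta> = csqrt z"
  define \<alpha> where "\<alpha> = - w / \<beta>"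
  have \<beta>2: "\<beta>\<^sup>2 = z" by (simp add: \<beta>_def)
  have \<beta>0: "\<beta> \<noteq> 0" using z \<beta>2 by auto
  have "\<bar>Im \<beta>\<bar> < Re \<beta>"
  proof -
    have "(Im \<beta>)\<^sup>2 < (Re \<beta>)\<^sup>2"
      using z unfolding \<beta>2[symmetric] by (simp add: power2_eq_square)
    then have "\<bar>Im \<beta>\<bar> < \<bar>Re \<beta>\<bar>" by (metis abs_le_square_iff not_le)
    moreover have "0 \<le> Re \<beta>" using csqrt_principal[of z] by (auto simp: \<beta>_def)
    ultimately show ?thesis by simp
  qed
  note lim = rotated_gaussian_integral[OF this, of \<alpha>]
  let ?f = "\<lambda>x::real. exp (- z * of_real (x\<^sup>2) / 2 + w * of_real x)"
  have eq: "\<beta> * exp (- (\<alpha> + \<beta> * of_real x)\<^sup>2 / 2) = (\<beta> * exp (- w\<^sup>2 / (2 * z))) * ?f x" for x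
  proof -
    have "- (\<alpha> + \<beta> * of_real x)\<^sup>2 / 2 = - w\<^sup>2 / (2 * z) + (- z * of_real (x\<^sup>2) / 2 + w * of_real x)"
      using \<beta>0 unfolding \<alpha>_def \<beta>2[symmetric] by (simp add: field_simps power2_eq_square)
    then show ?thesis by (simp only: exp_add mult.assoc)
  qed
  have int: "integrable lborel ?f" by (rule integrable_complex_gaussian[OF z])
  have "((\<lambda>R. \<integral>x. indicator {-R..R} x *\<^sub>R ((\<beta> * exp (- w\<^sup>2 / (2 * z))) * ?f x) \<partial>lborel)
      \<longlongrightarrow> (\<integral>x. (\<beta> * exp (- w\<^sup>2 / (2 * z))) * ?f x \<partial>lborel)) at_top"
    by (intro tendsto_integral_symmetric_interval integrable_mult_right int)
  from tendsto_unique[OF _ this lim[unfolded eq]]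
  have "(\<beta> * exp (- w\<^sup>2 / (2 * z))) * (\<integral>x. ?f x \<partial>lborel) = of_real (sqrt (2 * pi))"
    by simp
  moreover have "exp (- w\<^sup>2 / (2 * z)) * exp (w\<^sup>2 / (2 * z)) = 1"
    by (simp flip: exp_add)
  ultimately have "(\<integral>x. ?f x \<partial>lborel) = gauss_const z * exp (w\<^sup>2 / (2 * z))"
    using \<beta>0 unfolding gauss_const_def \<beta>_def[symmetric]
    by (simp add: field_simps exp_minus)
  with int show ?thesis by (simp add: has_bochner_integral_iff)
qed

text \<open>
Fubini's theorem for functions that factor over the coordinates.
\<close>
lemma lborel_integral_prod:
  fixes h :: "'a::euclidean_space \<Rightarrow> real \<Rightarrow> complex"
  assumes h: "\<And>b. b \<in> Basis \<Longrightarrow> has_bochner_integral lborel (h b) (I b)"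
  shows "has_bochner_integral lborel (\<lambda>x. \<Prod>b\<in>Basis. h b (x \<bullet> b)) (\<Prod>b\<in>Basis. I b)"
proof -
  interpret product_sigma_finite "\<lambda>_::'a. lborel :: real measure" ..
  have int: "\<And>b. b \<in> Basis \<Longrightarrow> integrable lborel (h b)"
    using h by (auto simp: has_bochner_integral_iff)
  have [measurable]: "\<And>b. b \<in> Basis \<Longrightarrow> h b \<in> borel_measurable borel"
    using int by (auto dest: borel_measurable_integrable)
  have "has_bochner_integral (\<Pi>\<^sub>M b\<in>Basis. lborel) (\<lambda>x. \<Prod>b\<in>Basis. h b (x b)) (\<Prod>b\<in>Basis. I b)"
    using product_integrable_prod[OF finite_Basis int] product_integral_prod[OF finite_Basis int] h
    by (auto simp: has_bochner_integral_iff)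
  then have "has_bochner_integral (\<Pi>\<^sub>M b\<in>Basis. lborel)
      (\<lambda>f. \<Prod>b\<in>Basis. h b ((\<Sum>b\<in>Basis. f b *\<^sub>R b) \<bullet> b)) (\<Prod>b\<in>Basis. I b)"
    by (simp cong: has_bochner_integral_cong prod.cong)
  then show ?thesis
    unfolding lborel_eq[where 'a='a]
    by (intro has_bochner_integral_distr) auto
qed

text \<open>
For functions that are not integrable both sides vanish. This allows substitutions in iterated
integrals before anything is known about the integrands.
\<close>
lemma lborel_integral_affine:
  fixes F :: "'a::euclidean_space \<Rightarrow> complex"
  assumes L: "0 < L"
  shows "(\<integral>x. F x \<partial>lborel) = of_real (L ^ DIM('a)) * (\<integral>u. F (a + L *\<^sub>R u) \<partial>lborel)"
proof (cases "F \<in> borel_measurable borel")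
  case True
  then have [measurable]: "F \<in> borel_measurable borel" .
  show ?thesis
    using L by (subst lborel_affine[of L a]) (simp_all add: integral_density integral_distr scaleR_conv_of_real)
next
  case False
  have "F \<in> borel_measurable borel" if "(\<lambda>u. F (a + L *\<^sub>R u)) \<in> borel_measurable borel"
  proof -
    have "(\<lambda>x. F (a + L *\<^sub>R ((x - a) /\<^sub>R L))) \<in> borel_measurable borel"
      by (rule measurable_compose[OF _ that]) measurable
    then show ?thesis using L by simp
  qed
  with False have "(\<lambda>u. F (a + L *\<^sub>R u)) \<notin> borel_measurable borel" by blast
  then have "\<not> integrable lborel (\<lambda>u. F (a + L *\<^sub>R u))"
    by (auto dest: borel_measurable_integrable)
  moreover have "\<not> integrable lborel F"
    using False by (auto dest: borel_measurable_integrable)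
  ultimately show ?thesis by (simp add: not_integrable_integral_eq)
qed

lemma lborel_nn_integral_affine:
  fixes F :: "'a::euclidean_space \<Rightarrow> ennreal"
  assumes L: "0 < L" and [measurable]: "F \<in> borel_measurable borel"
  shows "(\<integral>\<^sup>+x. F x \<partial>lborel) = ennreal (L ^ DIM('a)) * (\<integral>\<^sup>+u. F (a + L *\<^sub>R u) \<partial>lborel)"
  using L by (subst lborel_affine[of L a]) (simp_all add: nn_integral_density nn_integral_distr nn_integral_cmult)

lemma fourier_affine:
  fixes f :: "real ^ 'n \<Rightarrow> complex"
  assumes L: "0 < L"
  shows "fourier (\<lambda>x. exp (\<i> * of_real (a \<bullet> x)) * f (L *\<^sub>R (x - y))) (a + L *\<^sub>R \<xi>)
    = exp (- \<i> * of_real (L * (y \<bullet> \<xi>))) * fourier f \<xi> / of_real (L ^ CARD('n))"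
proof -
  have "fourier f \<xi> = of_real (L ^ CARD('n)) *
      (\<integral>x. f (- L *\<^sub>R y + L *\<^sub>R x) * exp (- \<i> * of_real ((- L *\<^sub>R y + L *\<^sub>R x) \<bullet> \<xi>)) \<partial>lborel)"
    unfolding fourier_def by (subst lborel_integral_affine[OF L, of _ "- L *\<^sub>R y"]) simp
  also have "(\<lambda>x. f (- L *\<^sub>R y + L *\<^sub>R x) * exp (- \<i> * of_real ((- L *\<^sub>R y + L *\<^sub>R x) \<bullet> \<xi>)))
     = (\<lambda>x. exp (\<i> * of_real (L * (y \<bullet> \<xi>))) *
        (exp (\<i> * of_real (a \<bullet> x)) * f (L *\<^sub>R (x - y)) * exp (- \<i> * of_real (x \<bullet> (a + L *\<^sub>R \<xi>)))))"
    by (simp add: fun_eq_iff inner_left_distrib inner_right_distrib inner_commute[of a] algebra_simps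
       flip: exp_add)
  finally have "fourier f \<xi> = of_real (L ^ CARD('n)) * (exp (\<i> * of_real (L * (y \<bullet> \<xi>))) *
      fourier (\<lambda>x. exp (\<i> * of_real (a \<bullet> x)) * f (L *\<^sub>R (x - y))) (a + L *\<^sub>R \<xi>))"
    by (simp add: fourier_def)
  moreover have "exp (- \<i> * of_real (L * (y \<bullet> \<xi>))) * exp (\<i> * of_real (L * (y \<bullet> \<xi>))) = 1"
    by (simp flip: exp_add)
  ultimately show ?thesis using L by (simp add: field_simps)
qed

lemma gaussian_integral:
  fixes z :: "'a::euclidean_space \<Rightarrow> complex"
  assumes "\<And>b. b \<in> Basis \<Longrightarrow> 0 < Re (z b)"
  shows "has_bochner_integral lborel (gaussian z w k)
     (\<Prod>b\<in>Basis. gauss_const (z b) * exp ((w b)\<^sup>2 / (2 * z b) + k b))"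
proof -
  have "has_bochner_integral lborel (\<lambda>x::'a. \<Prod>b\<in>Basis. exp (- z b * of_real ((x \<bullet> b)\<^sup>2) / 2 + w b * of_real (x \<bullet> b)) * exp (k b))
     (\<Prod>b\<in>Basis. gauss_const (z b) * exp ((w b)\<^sup>2 / (2 * z b)) * exp (k b))"
    using assms by (intro lborel_integral_prod has_bochner_integral_mult_left complex_gaussian_integral)
  then show ?thesis unfolding gaussian_def exp_add mult.assoc .
qed

lemma fourier_gaussian:
  fixes z :: "real ^ 'n \<Rightarrow> complex"
  assumes "\<And>b. b \<in> Basis \<Longrightarrow> 0 < Re (z b)"
  shows "fourier (gaussian z (\<lambda>_. 0) (\<lambda>_. 0)) \<xi>
    = (\<Prod>b\<in>Basis. gauss_const (z b)) * gaussian (\<lambda>b. 1 / z b) (\<lambda>_. 0) (\<lambda>_. 0) \<xi>"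
proof -
  have "gaussian z (\<lambda>_. 0) (\<lambda>_. 0) x * exp (- \<i> * of_real (x \<bullet> \<xi>)) = gaussian z (\<lambda>b. - \<i> * of_real (\<xi> \<bullet> b)) (\<lambda>_. 0) x" for x
    unfolding gaussian_eq_exp euclidean_inner[of x \<xi>]
    by (simp add: sum.distrib[symmetric] sum_distrib_left sum_negf[symmetric] flip: exp_add)
       (intro arg_cong[of _ _ exp] sum.cong; simp add: algebra_simps)
  then have "fourier (gaussian z (\<lambda>_. 0) (\<lambda>_. 0)) \<xi> = (\<Prod>b\<in>Basis. gauss_const (z b) * exp ((- \<i> * of_real (\<xi> \<bullet> b))\<^sup>2 / (2 * z b) + 0))"
    unfolding fourier_def using gaussian_integral[OF assms, where w="\<lambda>b. - \<i> * of_real (\<xi> \<bullet> b)" and k="\<lambda>_. 0"]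
    by (simp add: has_bochner_integral_iff)
  also have "\<dots> = (\<Prod>b\<in>Basis. gauss_const (z b) * exp (- (1 / z b) * of_real ((\<xi> \<bullet> b)\<^sup>2) / 2 + 0 * of_real (\<xi> \<bullet> b) + 0))"
    by (simp add: power_mult_distrib field_simps)
  finally show ?thesis by (simp add: gaussian_def prod.distrib)
qed

lemma nn_integral_product_gaussian:
  fixes h :: "'a::euclidean_space \<Rightarrow> complex"
  assumes h: "\<And>x. norm (h x) = A * (\<Prod>b\<in>Basis. exp (- a b * (x \<bullet> b)\<^sup>2))"
    and A: "0 \<le> A" and a: "\<And>b. b \<in> Basis \<Longrightarrow> 0 < a b" and p: "0 < p"
  shows "(\<integral>\<^sup>+x. ennreal (norm (h x) powr p) \<partial>lborel) = ennreal (A powr p * (\<Prod>b\<in>Basis. sqrt (pi / (p * a b))))"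
proof -
  have "norm (h x) powr p = A powr p * (\<Prod>b\<in>Basis. exp (- (p * a b) * (x \<bullet> b)\<^sup>2))" for x
  proof -
    have "norm (h x) powr p = A powr p * exp (\<Sum>b\<in>Basis. - a b * (x \<bullet> b)\<^sup>2) powr p"
      using A by (simp add: h powr_mult exp_sum[OF finite_Basis, symmetric])
    also have "exp (\<Sum>b\<in>Basis. - a b * (x \<bullet> b)\<^sup>2) powr p = exp (\<Sum>b\<in>Basis. - (p * a b) * (x \<bullet> b)\<^sup>2)"
      by (simp add: powr_def sum_distrib_left mult.assoc)
    finally show ?thesis by (simp add: exp_sum)
  qed
  then have "(\<integral>\<^sup>+x. ennreal (norm (h x) powr p) \<partial>lborel)
      = (\<integral>\<^sup>+x. ennreal (A powr p) * (\<Prod>b\<in>Basis. ennreal (exp (- (p * a b) * (x \<bullet> b)\<^sup>2))) \<partial>lborel)"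
    by (simp add: ennreal_mult' prod_ennreal)
  also have "\<dots> = ennreal (A powr p) * (\<integral>\<^sup>+x. (\<Prod>b\<in>Basis. ennreal (exp (- (p * a b) * (x \<bullet> b)\<^sup>2))) \<partial>lborel)"
    by (rule nn_integral_cmult) measurable
  also have "(\<integral>\<^sup>+x. (\<Prod>b\<in>Basis. ennreal (exp (- (p * a b) * (x \<bullet> b)\<^sup>2))) \<partial>lborel)
      = (\<Prod>b\<in>Basis. (\<integral>\<^sup>+x. ennreal (exp (- (p * a b) * x\<^sup>2)) \<partial>lborel))"
    by (rule nn_integral_lborel_prod[where f = "\<lambda>b x. ennreal (exp (- (p * a b) * x\<^sup>2))"]) auto
  also have "\<dots> = (\<Prod>b\<in>Basis. ennreal (sqrt (pi / (p * a b))))"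
  proof (intro prod.cong refl)
    fix b :: 'a assume "b \<in> Basis"
    then have "0 < p * a b" using a p by auto
    from real_gaussian_integral[OF this]
    show "(\<integral>\<^sup>+x. ennreal (exp (- (p * a b) * x\<^sup>2)) \<partial>lborel) = ennreal (sqrt (pi / (p * a b)))"
      by (subst nn_integral_eq_integral) (auto simp: has_bochner_integral_iff)
  qed
  also have "ennreal (A powr p) * \<dots> = ennreal (A powr p * (\<Prod>b\<in>Basis. sqrt (pi / (p * a b))))"
    using a p by (subst prod_ennreal) (auto simp: ennreal_mult' intro!: order.strict_implies_order)
  finally show ?thesis .
qed

lemma Lp_norm_gaussian:
  fixes z :: "real ^ 'n \<Rightarrow> complex"
  assumes z: "\<And>b. b \<in> Basis \<Longrightarrow> 0 < Re (z b)" and p: "0 < p"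
  shows "Lp_norm p (gaussian z (\<lambda>_. 0) (\<lambda>_. 0))
    = ennreal ((\<Prod>b\<in>Basis. sqrt (2 * pi / (p * Re (z b)))) powr (1 / p))"
proof -
  have "(\<integral>\<^sup>+x. ennreal (norm (gaussian z (\<lambda>_. 0) (\<lambda>_. 0) x) powr p) \<partial>lborel)
      = ennreal (1 powr p * (\<Prod>b\<in>Basis. sqrt (pi / (p * (Re (z b) / 2)))))"
    by (rule nn_integral_product_gaussian) (use z p in \<open>auto simp: norm_gaussian\<close>)
  moreover have "0 \<le> (\<Prod>b\<in>Basis. sqrt (pi / (p * (Re (z b) / 2))))"
    by (intro prod_nonneg) (use z p in \<open>auto simp: order.strict_implies_order\<close>)
  ultimately show ?thesis by (simp add: Lp_norm_def mult.commute)
qed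

section \<open>Bilinear operators with bounded continuous multipliers\<close>

text \<open>
The bilinear operator with symbol \<open>m(u, v)\<close>, applied to two equal functions, as a
function of their common Fourier transform \<open>F\<close>.
\<close>
definition multiplier_op :: "('a::euclidean_space \<Rightarrow> 'a \<Rightarrow> complex) \<Rightarrow> ('a \<Rightarrow> complex) \<Rightarrow> 'a \<Rightarrow> complex" where
  "multiplier_op m F y = (LINT v|lborel. LINT u|lborel. m u v * F u * F v * exp (\<i> * of_real (y \<bullet> (u + v))))"

lemma continuous_imp_measurable_pair:
  fixes f :: "'a::second_countable_topology \<times> 'b::second_countable_topology \<Rightarrow> 'c::topological_space"
  assumes f: "continuous_on UNIV f" and M: "sets M = sets borel" "sets N = sets borel"
  shows "f \<in> borel_measurable (M \<Otimes>\<^sub>M N)"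
proof -
  have "f \<in> borel_measurable (borel \<Otimes>\<^sub>M borel)"
    unfolding borel_prod by (rule borel_measurable_continuous_onI[OF f])
  then show ?thesis
    using measurable_cong_sets[OF sets_pair_measure_cong[OF M] refl] by blast
qed

text \<open>
Measurability of the values, which Fatou's lemma asks for; it comes from joint continuity of the integrand.
\<close>
lemma multiplier_op_measurable:
  fixes m :: "'a::euclidean_space \<Rightarrow> 'a \<Rightarrow> complex"
  assumes m: "continuous_on UNIV (\<lambda>(u, v). m u v)" and F: "continuous_on UNIV F"
  shows "multiplier_op m F \<in> borel_measurable borel"
proof -
  have m': "continuous_on UNIV (\<lambda>p. m (a p) (b p))"
    if "continuous_on UNIV a" "continuous_on UNIV b" for a b :: "('a \<times> 'a) \<times> 'a \<Rightarrow> 'a"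
    using continuous_on_compose2[OF m, of UNIV "\<lambda>p. (a p, b p)"] that by (auto intro!: continuous_intros)
  have F': "continuous_on UNIV (\<lambda>p. F (a p))" if "continuous_on UNIV a" for a :: "('a \<times> 'a) \<times> 'a \<Rightarrow> 'a"
    using continuous_on_compose2[OF F that] by auto
  have "continuous_on UNIV (\<lambda>p::('a \<times> 'a) \<times> 'a. m (snd p) (snd (fst p)) * F (snd p) * F (snd (fst p))
      * exp (\<i> * of_real (fst (fst p) \<bullet> (snd p + snd (fst p)))))"
    by (intro continuous_intros m' F')
  then have "(\<lambda>p::('a \<times> 'a) \<times> 'a. m (snd p) (snd (fst p)) * F (snd p) * F (snd (fst p))
      * exp (\<i> * of_real (fst (fst p) \<bullet> (snd p + snd (fst p))))) \<in> borel_measurable ((borel \<Otimes>\<^sub>M lborel) \<Otimes>\<^sub>M lborel)"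
  proof (rule continuous_imp_measurable_pair)
    show "sets (borel \<Otimes>\<^sub>M lborel) = sets (borel :: ('a \<times> 'a) measure)"
      using sets_pair_measure_cong[OF refl sets_lborel] by (metis borel_prod)
  qed auto
  then have "(\<lambda>(q, u). m u (snd q) * F u * F (snd q)
      * exp (\<i> * of_real (fst q \<bullet> (u + snd q)))) \<in> borel_measurable ((borel \<Otimes>\<^sub>M lborel) \<Otimes>\<^sub>M lborel)"
    by (simp add: case_prod_beta')
  from lborel.borel_measurable_lebesgue_integral[OF this]
  have "(\<lambda>(y, v). LINT u|lborel. m u v * F u * F v * exp (\<i> * of_real (y \<bullet> (u + v)))) \<in> borel_measurable (borel \<Otimes>\<^sub>M lborel)"
    by (simp add: case_prod_beta')
  from lborel.borel_measurable_lebesgue_integral[OF this]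
  show ?thesis by (simp add: multiplier_op_def[abs_def])
qed

text \<open>
Dominated convergence in the inner and then in the outer integral, with the majorant \<open>|F(u)| |F(v)|\<close>.
\<close>
lemma multiplier_op_tendsto:
  fixes m :: "nat \<Rightarrow> 'a::euclidean_space \<Rightarrow> 'a \<Rightarrow> complex"
  assumes m: "\<And>k. continuous_on UNIV (\<lambda>(u, v). m k u v)" "continuous_on UNIV (\<lambda>(u, v). m' u v)"
    and bound: "\<And>k u v. norm (m k u v) \<le> 1"
    and lim: "\<And>u v. (\<lambda>k. m k u v) \<longlonglongrightarrow> m' u v"
    and F: "continuous_on UNIV F" "integrable lborel F"
  shows "(\<lambda>k. multiplier_op (m k) F y) \<longlonglongrightarrow> multiplier_op m' F y"
proof -
  have meas: "(\<lambda>p. n (snd p) (fst p) * F (snd p) * F (fst p) * exp (\<i> * of_real (y \<bullet> (snd p + fst p))))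
      \<in> borel_measurable (lborel \<Otimes>\<^sub>M lborel)"
    if n: "continuous_on UNIV (\<lambda>(u, v). n u v)" for n :: "'a \<Rightarrow> 'a \<Rightarrow> complex"
  proof -
    have "continuous_on UNIV (\<lambda>p::'a \<times> 'a. n (snd p) (fst p))"
      using continuous_on_compose2[OF n continuous_on_swap, of UNIV] by (simp add: case_prod_beta')
    moreover have "continuous_on UNIV (\<lambda>p::'a \<times> 'a. F (fst p))" "continuous_on UNIV (\<lambda>p::'a \<times> 'a. F (snd p))"
      by (rule continuous_on_compose2[OF F(1)]; auto intro!: continuous_intros)+
    ultimately have "continuous_on UNIV (\<lambda>p. n (snd p) (fst p) * F (snd p) * F (fst p) * exp (\<i> * of_real (y \<bullet> (snd p + fst p))))"
      by (intro continuous_intros)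
    then show ?thesis by (rule continuous_imp_measurable_pair) auto
  qed
  have inner: "(\<lambda>u. n u v * F u * F v * exp (\<i> * of_real (y \<bullet> (u + v)))) \<in> borel_measurable lborel"
    if n: "continuous_on UNIV (\<lambda>(u, v). n u v)" for n :: "'a \<Rightarrow> 'a \<Rightarrow> complex" and v
    using measurable_compose[OF measurable_Pair1' meas[OF n], of v] by simp
  have outer: "(\<lambda>v. LINT u|lborel. n u v * F u * F v * exp (\<i> * of_real (y \<bullet> (u + v)))) \<in> borel_measurable lborel"
    if n: "continuous_on UNIV (\<lambda>(u, v). n u v)" for n :: "'a \<Rightarrow> 'a \<Rightarrow> complex"
    using lborel.borel_measurable_lebesgue_integral[of "\<lambda>v u. n u v * F u * F v * exp (\<i> * of_real (y \<bullet> (u + v)))" lborel] meas[OF n]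
    by (simp add: case_prod_beta')
  have dom: "norm (m k u v * F u * F v * exp (\<i> * of_real (y \<bullet> (u + v)))) \<le> norm (F v) * norm (F u)" for k u v
    using mult_right_mono[OF bound[of k u v], of "norm (F u) * norm (F v)"] by (simp add: norm_mult mult_ac)
  have intF: "integrable lborel (\<lambda>u. norm (F v) * norm (F u))" for v
    using F(2) by auto
  show ?thesis
    unfolding multiplier_op_def
  proof (rule integral_dominated_convergence)
    show "integrable lborel (\<lambda>v. norm (F v) * (LINT u|lborel. norm (F u)))" using F(2) by auto
    show "AE v in lborel. (\<lambda>k. LINT u|lborel. m k u v * F u * F v * exp (\<i> * of_real (y \<bullet> (u + v))))
        \<longlonglongrightarrow> (LINT u|lborel. m' u v * F u * F v * exp (\<i> * of_real (y \<bullet> (u + v))))"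
    proof (rule AE_I2)
      fix v
      show "(\<lambda>k. LINT u|lborel. m k u v * F u * F v * exp (\<i> * of_real (y \<bullet> (u + v))))
        \<longlonglongrightarrow> (LINT u|lborel. m' u v * F u * F v * exp (\<i> * of_real (y \<bullet> (u + v))))"
        by (rule integral_dominated_convergence[OF inner inner intF[of v]])
           (auto intro!: m dom AE_I2 tendsto_intros lim)
    qed
    show "AE v in lborel. norm (LINT u|lborel. m k u v * F u * F v * exp (\<i> * of_real (y \<bullet> (u + v))))
        \<le> norm (F v) * (LINT u|lborel. norm (F u))" for k
    proof (rule AE_I2)
      fix v
      have "norm (LINT u|lborel. m k u v * F u * F v * exp (\<i> * of_real (y \<bullet> (u + v))))
        \<le> (LINT u|lborel. norm (F v) * norm (F u))"
        by (rule order.trans[OF integral_norm_bound], rule integral_mono'[OF intF]) (auto intro: dom)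
      then show "norm (LINT u|lborel. m k u v * F u * F v * exp (\<i> * of_real (y \<bullet> (u + v))))
        \<le> norm (F v) * (LINT u|lborel. norm (F u))" by simp
    qed
  qed (rule outer, rule m)+
qed

section \<open>Blowing up the symbol at a high frequency\<close>

text \<open>
In the blow-up \<open>frequency\<close> is \<open>N\<close> and \<open>dilation\<close> is \<open>L\<close>. The factor \<open>1 / sqrt (1 - s)\<close> in \<open>L\<close> normalises the
coefficient of the quadratic term in the limit to \<open>-1\<close>.
\<close>
definition frequency :: "nat \<Rightarrow> real" where "frequency k = real (Suc k)"

definition dilation :: "real \<Rightarrow> nat \<Rightarrow> real" where "dilation s k = frequency k powr (1 - s / 2) / sqrt (1 - s)"

lemma frequency_pos: "0 < frequency k" by (simp add: frequency_def)

lemma dilation_pos: "s < 1 \<Longrightarrow> 0 < dilation s k" using frequency_pos[of k] by (simp add: dilation_def)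

text \<open>
The phase around \<open>(0, N e\<^sub>j)\<close> in the units \<open>L\<close>, without its linear part. The
subtracted term amounts to a translation of \<open>f\<close> by \<open>N powr (s - 1)\<close>.
\<close>
definition rescaled_phase :: "'n::finite \<Rightarrow> real \<Rightarrow> nat \<Rightarrow> real ^ 'n \<Rightarrow> real ^ 'n \<Rightarrow> real" where
  "rescaled_phase j s k u v = phase j s (0, dilation s k *\<^sub>R u, frequency k *\<^sub>R axis j 1 + dilation s k *\<^sub>R v)
     - dilation s k * frequency k powr (s - 1) * (u $ j)"

text \<open>
With \<open>eps = L / N\<close> and \<open>K = 1 / sqrt (1 - s)\<close> the phase is \<open>K\<^sup>2 u\<^sub>j ((1 + y) powr a - 1) / eps\<close>,
where \<open>a = (s - 1) / 2\<close> and \<open>y = 2 eps v\<^sub>j + o(eps)\<close>. The limit is therefore \<open>2 a K\<^sup>2 u\<^sub>j v\<^sub>j\<close>,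
the derivative of \<open>(1 + y) powr a\<close> at \<open>0\<close> giving the factor \<open>a\<close>. The product \<open>u\<^sub>j v\<^sub>j\<close> is the only quadratic term because \<open>\<xi>\<^sub>j\<close> vanishes at
the centre and the weight changes to first order only in the direction of \<open>\<eta>\<^sub>j\<close>.
\<close>
lemma rescaled_phase_tendsto:
  fixes u v :: "real ^ 'n"
  assumes s: "0 < s" "s < 1"
  shows "(\<lambda>k. rescaled_phase j s k u v) \<longlonglongrightarrow> - (u $ j) * (v $ j)"
proof -
  define a where "a = (s - 1) / 2"
  define K where "K = 1 / sqrt (1 - s)"
  have K: "0 < K" "K\<^sup>2 = 1 / (1 - s)" using s by (simp_all add: K_def power_divide)
  \<comment> \<open>\<open>eps\<close> is \<open>L / N\<close>, and \<open>N\<^sup>2 (1 + y)\<close> is the weight at the rescaled point.\<close>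
  define eps where "eps k = K * frequency k powr (- s / 2)" for k
  define y where "y k = 1 / (frequency k)\<^sup>2 + (eps k)\<^sup>2 * ((norm u)\<^sup>2 + (norm v)\<^sup>2) + 2 * eps k * (v $ j)" for k
  have eps_pos: "0 < eps k" for k using K frequency_pos[of k] by (simp add: eps_def)
  have L: "dilation s k = eps k * frequency k" for k
    using frequency_pos[of k] by (simp add: dilation_def eps_def K_def powr_diff powr_minus_divide)
  have LN: "dilation s k * frequency k powr (s - 1) = K\<^sup>2 / eps k" for k
  proof -
    have "dilation s k * frequency k powr (s - 1) * eps k = K\<^sup>2 * (frequency k powr (1 - s/2) * frequency k powr (s - 1) * frequency k powr (- s / 2))"
      by (simp add: dilation_def eps_def K_def power2_eq_square)
    also have "frequency k powr (1 - s/2) * frequency k powr (s - 1) * frequency k powr (- s / 2) = 1"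
      using frequency_pos[of k] by (simp flip: powr_add)
    finally show ?thesis using eps_pos[of k] by (simp add: field_simps)
  qed
  have w: "weight (0, dilation s k *\<^sub>R u, frequency k *\<^sub>R axis j 1 + dilation s k *\<^sub>R v) = (frequency k)\<^sup>2 * (1 + y k)" for k
  proof -
    have "(norm (frequency k *\<^sub>R axis j 1 + dilation s k *\<^sub>R v))\<^sup>2 = (frequency k)\<^sup>2 + 2 * frequency k * dilation s k * (v $ j) + (dilation s k)\<^sup>2 * (norm v)\<^sup>2"
      unfolding power2_norm_eq_inner
      by (simp add: inner_add_left inner_add_right inner_axis' inner_axis power2_eq_square algebra_simps)
    then have "weight (0, dilation s k *\<^sub>R u, frequency k *\<^sub>R axis j 1 + dilation s k *\<^sub>R v)
      = 1 + (dilation s k)\<^sup>2 * (norm u)\<^sup>2 + ((frequency k)\<^sup>2 + 2 * frequency k * dilation s k * (v $ j) + (dilation s k)\<^sup>2 * (norm v)\<^sup>2)"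
      by (simp add: weight_def power_mult_distrib)
    also have "\<dots> = (frequency k)\<^sup>2 * (1 + y k)"
      using frequency_pos[of k] by (simp add: y_def L power2_eq_square field_simps)
    finally show ?thesis .
  qed
  have y1: "0 < 1 + y k" for k
    using weight_ge_1[of "(0, dilation s k *\<^sub>R u, frequency k *\<^sub>R axis j 1 + dilation s k *\<^sub>R v)"] frequency_pos[of k]
    unfolding w by (smt (verit) zero_less_mult_iff zero_less_power)
  have ph: "rescaled_phase j s k u v = K\<^sup>2 / eps k * (u $ j) * ((1 + y k) powr a - 1)" for k
  proof -
    have "((frequency k)\<^sup>2 * (1 + y k)) powr a = frequency k powr (s - 1) * (1 + y k) powr a"
    proof -
      have "((frequency k)\<^sup>2 * (1 + y k)) powr a = (frequency k powr 2) powr a * (1 + y k) powr a"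
        using frequency_pos[of k] y1[of k] by (simp add: powr_mult)
      also have "(frequency k powr 2) powr a = frequency k powr (2 * a)" by (simp only: powr_powr)
      also have "2 * a = s - 1" by (simp add: a_def)
      finally show ?thesis .
    qed
    then have "rescaled_phase j s k u v = dilation s k * frequency k powr (s - 1) * (u $ j) * ((1 + y k) powr a - 1)"
      unfolding rescaled_phase_def phase_def w coord_def a_def[symmetric] by (simp add: right_diff_distrib mult_ac)
    then show ?thesis by (simp only: LN)
  qed
  have "((\<lambda>t. (1 + t) powr a) has_field_derivative a) (at 0)"
    by (auto intro!: derivative_eq_intros)
  \<comment> \<open>Caratheodory's form of the derivative stays meaningful where \<open>y k = 0\<close>.\<close>
  then obtain q where q: "\<And>t. (1 + t) powr a - 1 = q t * t" "isCont q 0" "q 0 = a"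
    unfolding CARAT_DERIV by auto
  have eps0: "eps \<longlonglongrightarrow> 0" unfolding eps_def frequency_def using s by real_asymp
  have N0: "(\<lambda>k. 1 / (frequency k)\<^sup>2 / eps k) \<longlonglongrightarrow> 0" unfolding eps_def frequency_def using s K by real_asymp
  have N1: "(\<lambda>k. 1 / (frequency k)\<^sup>2) \<longlonglongrightarrow> 0" unfolding frequency_def by real_asymp
  have "y \<longlonglongrightarrow> 0 + 0\<^sup>2 * ((norm u)\<^sup>2 + (norm v)\<^sup>2) + 2 * 0 * (v $ j)"
    unfolding y_def by (intro tendsto_intros eps0 N1)
  then have "(\<lambda>k. q (y k)) \<longlonglongrightarrow> a"
    using isCont_tendsto_compose[OF q(2)] q(3) by simp
  moreover have "(\<lambda>k. 1 / (frequency k)\<^sup>2 / eps k + eps k * ((norm u)\<^sup>2 + (norm v)\<^sup>2) + 2 * (v $ j))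
     \<longlonglongrightarrow> 0 + 0 * ((norm u)\<^sup>2 + (norm v)\<^sup>2) + 2 * (v $ j)"
    by (intro tendsto_intros eps0 N0)
  ultimately have "(\<lambda>k. K\<^sup>2 * (u $ j) * q (y k) * (1 / (frequency k)\<^sup>2 / eps k + eps k * ((norm u)\<^sup>2 + (norm v)\<^sup>2) + 2 * (v $ j)))
     \<longlonglongrightarrow> K\<^sup>2 * (u $ j) * a * (0 + 0 * ((norm u)\<^sup>2 + (norm v)\<^sup>2) + 2 * (v $ j))"
    by (intro tendsto_intros N0 eps0)
  moreover have "K\<^sup>2 * (u $ j) * q (y k) * (1 / (frequency k)\<^sup>2 / eps k + eps k * ((norm u)\<^sup>2 + (norm v)\<^sup>2) + 2 * (v $ j))
     = rescaled_phase j s k u v" for k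
  proof -
    have "1 / (frequency k)\<^sup>2 / eps k + eps k * ((norm u)\<^sup>2 + (norm v)\<^sup>2) + 2 * (v $ j) = y k / eps k"
      using eps_pos[of k] by (simp add: y_def add_divide_distrib power2_eq_square)
    then show ?thesis by (simp add: ph q(1))
  qed
  moreover have "K\<^sup>2 * (u $ j) * a * (0 + 0 * ((norm u)\<^sup>2 + (norm v)\<^sup>2) + 2 * (v $ j)) = - (u $ j) * (v $ j)"
    using s by (simp add: K a_def field_simps)
  ultimately show ?thesis by simp
qed

text \<open>
The operator on modulated, translated and dilated functions is, up to a unimodular factor and a
dilation, the operator with the rescaled symbol on the original functions. The translation
of the first function cancels the linear part of the phase.
\<close>
lemma bilinear_op_rescaled:
  fixes f :: "real ^ 'n \<Rightarrow> complex"
  assumes s: "s < 1"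
  shows "bilinear_op (osc_symbol j s)
      (\<lambda>x. exp (\<i> * of_real (0 \<bullet> x)) * f (dilation s k *\<^sub>R (x - frequency k powr (s - 1) *\<^sub>R axis j 1)))
      (\<lambda>x. exp (\<i> * of_real ((frequency k *\<^sub>R axis j 1) \<bullet> x)) * f (dilation s k *\<^sub>R (x - 0))) x
    = exp (\<i> * of_real (frequency k * (x $ j))) *
      multiplier_op (\<lambda>u v. exp (\<i> * of_real (rescaled_phase j s k u v))) (fourier f) (dilation s k *\<^sub>R x)"
    (is "bilinear_op _ ?f ?g x = _")
proof -
  let ?L = "dilation s k" and ?N = "frequency k" and ?e = "axis j 1 :: real ^ 'n" and ?n = "CARD('n)"
  let ?\<tau> = "frequency k powr (s - 1)"
  have L: "0 < ?L" by (rule dilation_pos[OF s])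
  have integrand: "osc_symbol j s (x, 0 + ?L *\<^sub>R u, ?N *\<^sub>R ?e + ?L *\<^sub>R v) * fourier ?f (0 + ?L *\<^sub>R u)
      * fourier ?g (?N *\<^sub>R ?e + ?L *\<^sub>R v) * exp (\<i> * of_real (x \<bullet> ((0 + ?L *\<^sub>R u) + (?N *\<^sub>R ?e + ?L *\<^sub>R v))))
    = (exp (\<i> * of_real (?N * (x $ j))) / of_real (?L ^ ?n)) / of_real (?L ^ ?n) *
      (exp (\<i> * of_real (rescaled_phase j s k u v)) * fourier f u * fourier f v
        * exp (\<i> * of_real ((?L *\<^sub>R x) \<bullet> (u + v))))" for u v
  proof -
    have ph: "phase j s (x, 0 + ?L *\<^sub>R u, ?N *\<^sub>R ?e + ?L *\<^sub>R v) = rescaled_phase j s k u v + ?L * ?\<tau> * (u $ j)"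
      by (simp add: rescaled_phase_def phase_def coord_def weight_def)
    have f: "fourier ?f (0 + ?L *\<^sub>R u) = exp (- \<i> * of_real (?L * (?\<tau> * (u $ j)))) * fourier f u / of_real (?L ^ ?n)"
      by (subst fourier_affine[OF L]) (simp add: inner_axis')
    have g: "fourier ?g (?N *\<^sub>R ?e + ?L *\<^sub>R v) = fourier f v / of_real (?L ^ ?n)"
      by (subst fourier_affine[OF L]) simp
    \<comment> \<open>The unimodular factors are collected first; \<open>?B\<close>, from the translation, cancels the linear phase in \<open>?A\<close>.\<close>
    let ?A = "exp (\<i> * of_real (rescaled_phase j s k u v + ?L * ?\<tau> * (u $ j)))"
    let ?B = "exp (- \<i> * of_real (?L * (?\<tau> * (u $ j))))"
    let ?D = "exp (\<i> * of_real (x \<bullet> ((0 + ?L *\<^sub>R u) + (?N *\<^sub>R ?e + ?L *\<^sub>R v))))"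
    let ?X = "exp (\<i> * of_real (?N * (x $ j)))"
    let ?Y = "exp (\<i> * of_real (rescaled_phase j s k u v))"
    let ?Z = "exp (\<i> * of_real ((?L *\<^sub>R x) \<bullet> (u + v)))"
    have "?A * ?B * ?D = ?X * ?Y * ?Z"
      by (simp add: inner_add_right inner_axis algebra_simps flip: exp_add)
    moreover have "?A * (?B * fourier f u / of_real (?L ^ ?n)) * (fourier f v / of_real (?L ^ ?n)) * ?D
      = (?A * ?B * ?D) * (fourier f u * fourier f v / of_real (?L ^ ?n) / of_real (?L ^ ?n))"
      by simp
    ultimately show ?thesis
      unfolding f g osc_symbol_def ph by simp
  qed
  have "bilinear_op (osc_symbol j s) ?f ?g x = of_real (?L ^ ?n) * (LINT v|lborel. of_real (?L ^ ?n) * (LINT u|lborel.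
      osc_symbol j s (x, 0 + ?L *\<^sub>R u, ?N *\<^sub>R ?e + ?L *\<^sub>R v) * fourier ?f (0 + ?L *\<^sub>R u)
      * fourier ?g (?N *\<^sub>R ?e + ?L *\<^sub>R v) * exp (\<i> * of_real (x \<bullet> ((0 + ?L *\<^sub>R u) + (?N *\<^sub>R ?e + ?L *\<^sub>R v))))))"
    unfolding bilinear_op_def
    by (subst lborel_integral_affine[OF L, where a="?N *\<^sub>R ?e"], subst lborel_integral_affine[OF L, where a=0]) simp
  also have "\<dots> = exp (\<i> * of_real (frequency k * (x $ j))) *
      multiplier_op (\<lambda>u v. exp (\<i> * of_real (rescaled_phase j s k u v))) (fourier f) (dilation s k *\<^sub>R x)"
    unfolding integrand multiplier_op_def using L by simp
  finally show ?thesis .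
qed

section \<open>The limit operator\<close>

lemma Lp_norm_cong_norm: "(\<And>x. norm (f x) = norm (g x)) \<Longrightarrow> Lp_norm p f = Lp_norm p g"
  by (simp add: Lp_norm_def)

lemma Lp_norm_affine:
  fixes h :: "real ^ 'n \<Rightarrow> complex"
  assumes L: "0 < L" and [measurable]: "h \<in> borel_measurable borel"
  shows "Lp_norm p h = ennreal (L powr (real CARD('n) / p)) * Lp_norm p (\<lambda>x. h (L *\<^sub>R (x - y)))"
proof -
  let ?I = "\<integral>\<^sup>+x. ennreal (norm (h (L *\<^sub>R (x - y))) powr p) \<partial>lborel"
  have I: "(\<integral>\<^sup>+x. ennreal (norm (h x) powr p) \<partial>lborel) = ennreal (L ^ CARD('n)) * ?I"
    by (subst lborel_nn_integral_affine[OF L, of _ "- L *\<^sub>R y"]) (simp_all add: algebra_simps)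
  show ?thesis
  proof (cases "?I = \<infinity>")
    case True
    then show ?thesis using L by (simp add: Lp_norm_def I ennreal_mult_top)
  next
    case False
    then obtain r where r: "0 \<le> r" "?I = ennreal r" by (cases ?I) auto
    have "(L ^ CARD('n) * r) powr (1 / p) = L powr (real CARD('n) / p) * r powr (1 / p)"
      using L r by (simp add: powr_mult powr_powr flip: powr_realpow)
    then show ?thesis
      using L r unfolding Lp_norm_def I by (simp add: ennreal_mult'[symmetric])
  qed
qed

text \<open>
The passage from norms to the integrals to which Fatou's lemma applies.
\<close>
lemma nn_integral_le_of_Lp_norm_le:
  assumes "Lp_norm p h \<le> ennreal D" "0 \<le> D" "0 < p"
  shows "(\<integral>\<^sup>+x. ennreal (norm (h x) powr p) \<partial>lborel) \<le> ennreal (D powr p)"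
proof -
  let ?I = "\<integral>\<^sup>+x. ennreal (norm (h x) powr p) \<partial>lborel"
  have "?I \<noteq> \<infinity>" using assms by (auto simp: Lp_norm_def Let_def top_unique)
  then obtain r where r: "0 \<le> r" "?I = ennreal r" by (cases ?I) auto
  have "r powr (1 / p) \<le> D" using assms r by (simp add: Lp_norm_def)
  then have "(r powr (1 / p)) powr p \<le> D powr p" using assms by (intro powr_mono2) auto
  then show ?thesis using r assms by (simp add: powr_powr)
qed


lemma Re_inverse_pos:
  fixes w :: complex
  assumes "0 < Re w"
  shows "0 < Re (1 / w)"
proof -
  have "0 < (Re w)\<^sup>2 + (Im w)\<^sup>2" using assms by (simp add: add_pos_nonneg)
  with assms show ?thesis by (simp add: Re_divide)
qed

abbreviation coupling :: "('a::euclidean_space \<Rightarrow> real) \<Rightarrow> 'a \<Rightarrow> 'a \<Rightarrow> complex" where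
  "coupling \<kappa> \<equiv> \<lambda>u v. exp (- \<i> * of_real (\<Sum>b\<in>Basis. \<kappa> b * (u \<bullet> b) * (v \<bullet> b)))"

text \<open>
The coefficients for which \<open>coupling\<close> is the limit symbol \<open>exp (- i u\<^sub>j v\<^sub>j)\<close>.
\<close>
definition axis_indicator :: "'n::finite \<Rightarrow> real ^ 'n \<Rightarrow> real" where
  "axis_indicator j b = (if b = axis j 1 then 1 else 0)"

lemma sum_axis_indicator: "(\<Sum>b\<in>Basis. axis_indicator j b * (u \<bullet> b) * (v \<bullet> b)) = (u $ j) * (v $ j)"
proof -
  have "(\<Sum>b\<in>Basis. axis_indicator j b * (u \<bullet> b) * (v \<bullet> b)) = (\<Sum>b::real^'a\<in>Basis. if b = axis j 1 then (u $ j) * (v $ j) else 0)"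
    by (intro sum.cong) (auto simp: axis_indicator_def inner_axis)
  also have "\<dots> = (u $ j) * (v $ j)" by simp
  finally show ?thesis .
qed

text \<open>
A bound for the original operator gives, with the same constant and for each \<open>k\<close>, a bound for
the rescaled one: the powers of \<open>L\<close> cancel because \<open>1 / p = 1 / p1 + 1 / p2\<close>. Pointwise
convergence of the symbols and Fatou's lemma carry it over to the limit. The products on
the right are the norms of the Gaussian in the spaces with exponents \<open>p1\<close> and \<open>p2\<close>.
\<close>
lemma limit_op_bounded:
  fixes z :: "real ^ 'n \<Rightarrow> complex" and j :: 'n
  assumes s: "0 < s" "s < 1"
    and p: "0 < p" "0 < p1" "0 < p2" "1 / p = 1 / p1 + 1 / p2"
    and bound: "\<And>f g. f \<in> schwartz \<Longrightarrow> g \<in> schwartz \<Longrightarrow>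
      Lp_norm p (bilinear_op (osc_symbol j s) f g) \<le> ennreal C * Lp_norm p1 f * Lp_norm p2 g"
    and z: "\<And>b. b \<in> Basis \<Longrightarrow> 0 < Re (z b)"
  defines "f \<equiv> gaussian z (\<lambda>_. 0) (\<lambda>_. 0)"
  shows "(\<integral>\<^sup>+y. ennreal (norm (multiplier_op (coupling (axis_indicator j)) (fourier f) y) powr p) \<partial>lborel)
    \<le> ennreal ((max 0 C * (\<Prod>b\<in>Basis. sqrt (2 * pi / (p1 * Re (z b)))) powr (1 / p1)
              * (\<Prod>b\<in>Basis. sqrt (2 * pi / (p2 * Re (z b)))) powr (1 / p2)) powr p)"
proof -
  let ?m = "\<lambda>k u v. exp (\<i> * of_real (rescaled_phase j s k u v))"
  let ?m' = "coupling (axis_indicator j)"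
  let ?S = "\<lambda>k. multiplier_op (?m k) (fourier f)"
  let ?S' = "multiplier_op ?m' (fourier f)"
  define A1 where "A1 = (\<Prod>b\<in>Basis. sqrt (2 * pi / (p1 * Re (z b)))) powr (1 / p1)"
  define A2 where "A2 = (\<Prod>b\<in>Basis. sqrt (2 * pi / (p2 * Re (z b)))) powr (1 / p2)"
  have A: "0 \<le> A1" "0 \<le> A2" by (simp_all add: A1_def A2_def)
  have f1: "Lp_norm p1 f = ennreal A1" and f2: "Lp_norm p2 f = ennreal A2"
    unfolding f_def A1_def A2_def using z p by (auto intro: Lp_norm_gaussian)
  have cont_gauss: "continuous_on UNIV (gaussian w v k)" for w v k :: "real ^ 'n \<Rightarrow> complex"
    unfolding gaussian_def by (intro continuous_intros) auto
  have F: "fourier f = (\<lambda>x. (\<Prod>b\<in>Basis. gauss_const (z b)) * gaussian (\<lambda>b. 1 / z b) (\<lambda>_. 0) (\<lambda>_. 0) x)"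
    unfolding f_def by (rule ext) (rule fourier_gaussian, rule z)
  have Fcont: "continuous_on UNIV (fourier f)"
    unfolding F by (intro continuous_intros cont_gauss)
  have Fint: "integrable lborel (fourier f)"
    unfolding F by (intro integrable_mult_right integrable.intros[OF gaussian_integral] Re_inverse_pos z)
  have f_meas: "f \<in> borel_measurable borel"
    unfolding f_def by (rule borel_measurable_continuous_onI[OF cont_gauss])
  have mcont: "continuous_on UNIV (\<lambda>(u, v). ?m k u v)" for k
  proof -
    have "continuous_on UNIV (phase j s)"
      by (rule has_derivative_continuous_on) (rule has_derivative_at_withinI[OF phase_has_derivative])
    then have "continuous_on UNIV (\<lambda>p. phase j s (0, dilation s k *\<^sub>R fst p, frequency k *\<^sub>R axis j 1 + dilation s k *\<^sub>R snd p))"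
      by (rule continuous_on_compose2) (auto intro!: continuous_intros)
    then show ?thesis
      unfolding rescaled_phase_def case_prod_beta' by (intro continuous_intros)
  qed
  have mcont': "continuous_on UNIV (\<lambda>(u, v). ?m' u v)"
    unfolding case_prod_beta' by (intro continuous_intros)
  have lim: "(\<lambda>k. ?m k u v) \<longlonglongrightarrow> ?m' u v" for u v
  proof -
    have "(\<lambda>k. ?m k u v) \<longlonglongrightarrow> exp (\<i> * of_real (- (u $ j) * (v $ j)))"
      by (intro tendsto_intros rescaled_phase_tendsto s)
    then show ?thesis by (simp add: sum_axis_indicator)
  qed
  have S_meas: "?S k \<in> borel_measurable borel" for k
    by (rule multiplier_op_measurable[OF mcont Fcont])
  have S_bound: "(\<integral>\<^sup>+y. ennreal (norm (?S k y) powr p) \<partial>lborel) \<le> ennreal ((max 0 C * A1 * A2) powr p)" for k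
  proof (rule nn_integral_le_of_Lp_norm_le)
    define L where "L = dilation s k"
    have L: "0 < L" unfolding L_def by (rule dilation_pos[OF s(2)])
    let ?n = "real CARD('n)"
    let ?y = "frequency k powr (s - 1) *\<^sub>R axis j 1 :: real ^ 'n" and ?a = "frequency k *\<^sub>R axis j 1 :: real ^ 'n"
    let ?f = "\<lambda>x. exp (\<i> * of_real (0 \<bullet> x)) * f (L *\<^sub>R (x - ?y))"
    let ?g = "\<lambda>x. exp (\<i> * of_real (?a \<bullet> x)) * f (L *\<^sub>R (x - 0))"
    have "?f \<in> schwartz" "?g \<in> schwartz"
      unfolding f_def gaussian_affine using L z by (auto intro!: gaussian_in_schwartz)
    note b = bound[OF this]
    have n1: "ennreal A1 = ennreal (L powr (?n / p1)) * Lp_norm p1 ?f"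
    proof -
      have "Lp_norm p1 ?f = Lp_norm p1 (\<lambda>x. f (L *\<^sub>R (x - ?y)))" by (rule Lp_norm_cong_norm) (simp add: norm_mult)
      then show ?thesis using Lp_norm_affine[OF L f_meas, of p1 ?y] f1 by simp
    qed
    have n2: "ennreal A2 = ennreal (L powr (?n / p2)) * Lp_norm p2 ?g"
    proof -
      have "Lp_norm p2 ?g = Lp_norm p2 (\<lambda>x. f (L *\<^sub>R (x - 0)))" by (rule Lp_norm_cong_norm) (simp add: norm_mult)
      then show ?thesis using Lp_norm_affine[OF L f_meas, of p2 0] f2 by simp
    qed
    have "Lp_norm p (?S k) = ennreal (L powr (?n / p)) * Lp_norm p (\<lambda>x. ?S k (L *\<^sub>R (x - 0)))"
      by (rule Lp_norm_affine[OF L S_meas])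
    also have "Lp_norm p (\<lambda>x. ?S k (L *\<^sub>R (x - 0))) = Lp_norm p (bilinear_op (osc_symbol j s) ?f ?g)"
      by (rule Lp_norm_cong_norm) (unfold L_def bilinear_op_rescaled[OF s(2)], simp add: norm_mult)
    also have "ennreal (L powr (?n / p)) * \<dots> \<le> ennreal (L powr (?n / p)) * (ennreal C * Lp_norm p1 ?f * Lp_norm p2 ?g)"
      by (intro mult_left_mono b) auto
    also have "L powr (?n / p) = L powr (?n / p1) * L powr (?n / p2)"
    proof -
      have "?n / p = ?n * (1 / p)" by simp
      also have "\<dots> = ?n / p1 + ?n / p2" unfolding p(4) by (simp add: distrib_left)
      finally show ?thesis by (simp add: powr_add)
    qed
    also have "ennreal (L powr (?n / p1) * L powr (?n / p2)) * (ennreal C * Lp_norm p1 ?f * Lp_norm p2 ?g)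
      = ennreal C * ennreal A1 * ennreal A2"
      unfolding n1 n2 by (simp add: ennreal_mult mult_ac)
    also have "\<dots> = ennreal (max 0 C * A1 * A2)"
      using A by (cases "0 \<le> C") (auto simp: ennreal_mult ennreal_neg max_def)
    finally show "Lp_norm p (?S k) \<le> ennreal (max 0 C * A1 * A2)" .
  qed (use A p in auto)
  have "(\<integral>\<^sup>+y. ennreal (norm (?S' y) powr p) \<partial>lborel) = (\<integral>\<^sup>+y. liminf (\<lambda>k. ennreal (norm (?S k y) powr p)) \<partial>lborel)"
  proof (intro nn_integral_cong)
    fix y
    have "(\<lambda>k. ?S k y) \<longlonglongrightarrow> ?S' y"
      by (rule multiplier_op_tendsto[OF mcont mcont' _ lim Fcont Fint]) simp
    then have n: "(\<lambda>k. norm (?S k y)) \<longlonglongrightarrow> norm (?S' y)" by (rule tendsto_norm)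
    have "(\<lambda>k. norm (?S k y) powr p) \<longlonglongrightarrow> norm (?S' y) powr p"
      by (rule tendsto_powr'[OF n tendsto_const]) (simp add: p(1))
    then have "(\<lambda>k. ennreal (norm (?S k y) powr p)) \<longlonglongrightarrow> ennreal (norm (?S' y) powr p)"
      by (rule tendsto_ennrealI)
    from lim_imp_Liminf[OF trivial_limit_sequentially this]
    show "ennreal (norm (?S' y) powr p) = liminf (\<lambda>k. ennreal (norm (?S k y) powr p))" by (rule sym)
  qed
  also have "\<dots> \<le> liminf (\<lambda>k. \<integral>\<^sup>+y. ennreal (norm (?S k y) powr p) \<partial>lborel)"
    using S_meas by (intro nn_integral_liminf) measurable
  also have "\<dots> \<le> liminf (\<lambda>k. ennreal ((max 0 C * A1 * A2) powr p))"
    by (intro Liminf_mono always_eventually allI S_bound)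
  also have "\<dots> = ennreal ((max 0 C * A1 * A2) powr p)"
    by (simp add: Liminf_const)
  finally show ?thesis unfolding A1_def A2_def .
qed

text \<open>
Both integrations, first over \<open>u\<close> and then over \<open>v\<close>, are Gaussian, and the coordinates do
not interact. With \<open>\<zeta> = 1 / z\<close> for the coefficient of the Fourier transform, the first
integration adds \<open>\<kappa>\<^sup>2 z\<close> to the quadratic coefficient \<open>\<zeta>\<close> of the second.
\<close>
lemma multiplier_op_gaussian:
  fixes z :: "real ^ 'n \<Rightarrow> complex" and \<kappa> :: "real ^ 'n \<Rightarrow> real"
  assumes z: "\<And>b. b \<in> Basis \<Longrightarrow> 0 < Re (z b)"
  shows "multiplier_op (coupling \<kappa>) (fourier (gaussian z (\<lambda>_. 0) (\<lambda>_. 0))) y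
    = (\<Prod>b\<in>Basis. (gauss_const (z b))\<^sup>2 * gauss_const (1 / z b) * gauss_const (1 / z b + (of_real (\<kappa> b))\<^sup>2 * z b)
        * exp (of_real ((y \<bullet> b)\<^sup>2) * ((\<i> + of_real (\<kappa> b) * z b)\<^sup>2 / (2 * (1 / z b + (of_real (\<kappa> b))\<^sup>2 * z b)) - z b / 2)))"
proof -
  define c where "c = (\<Prod>b\<in>Basis. gauss_const (z b))"
  define \<zeta> where "\<zeta> b = 1 / z b" for b
  let ?G = "\<lambda>x. gaussian \<zeta> (\<lambda>_. 0) (\<lambda>_. 0) x"
  have \<zeta>: "\<And>b. b \<in> Basis \<Longrightarrow> 0 < Re (\<zeta> b)" unfolding \<zeta>_def by (intro Re_inverse_pos z)
  have F: "fourier (gaussian z (\<lambda>_. 0) (\<lambda>_. 0)) x = c * ?G x" for x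
    unfolding c_def \<zeta>_def by (rule fourier_gaussian) (rule z)
  have inner: "(LINT u|lborel. exp (- \<i> * of_real (\<Sum>b\<in>Basis. \<kappa> b * (u \<bullet> b) * (v \<bullet> b))) * (c * ?G u) * (c * ?G v) * exp (\<i> * of_real (y \<bullet> (u + v))))
      = c\<^sup>2 * (\<Prod>b\<in>Basis. gauss_const (\<zeta> b)) * gaussian (\<lambda>b. \<zeta> b + (of_real (\<kappa> b))\<^sup>2 * z b)
          (\<lambda>b. of_real (y \<bullet> b) * (\<i> + of_real (\<kappa> b) * z b)) (\<lambda>b. - z b * of_real ((y \<bullet> b)\<^sup>2) / 2) v" for v
  proof -
    have eq: "exp (- \<i> * of_real (\<Sum>b\<in>Basis. \<kappa> b * (u \<bullet> b) * (v \<bullet> b))) * (c * ?G u) * (c * ?G v) * exp (\<i> * of_real (y \<bullet> (u + v)))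
      = (c\<^sup>2 * (?G v * exp (\<i> * of_real (y \<bullet> v)))) * gaussian \<zeta> (\<lambda>b. \<i> * of_real (y \<bullet> b - \<kappa> b * (v \<bullet> b))) (\<lambda>_. 0) u" for u
    proof -
      have "exp (- \<i> * of_real (\<Sum>b\<in>Basis. \<kappa> b * (u \<bullet> b) * (v \<bullet> b))) * ?G u * exp (\<i> * of_real (y \<bullet> u))
        = gaussian \<zeta> (\<lambda>b. \<i> * of_real (y \<bullet> b - \<kappa> b * (v \<bullet> b))) (\<lambda>_. 0) u"
        unfolding gaussian_eq_exp euclidean_inner[of y u] exp_add[symmetric] of_real_sum sum_distrib_left sum.distrib[symmetric]
        by (intro arg_cong[of _ _ exp] sum.cong refl) (simp add: algebra_simps)
      moreover have "exp (\<i> * of_real (y \<bullet> (u + v))) = exp (\<i> * of_real (y \<bullet> u)) * exp (\<i> * of_real (y \<bullet> v))"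
        by (simp add: inner_add_right algebra_simps flip: exp_add)
      ultimately show ?thesis by (simp add: power2_eq_square mult_ac)
    qed
    \<comment> \<open>The result of the integration over \<open>u\<close> is again a Gaussian in \<open>v\<close>.\<close>
    have "(\<Prod>b\<in>Basis. exp ((\<i> * of_real (y \<bullet> b - \<kappa> b * (v \<bullet> b)))\<^sup>2 / (2 * \<zeta> b) + 0)) * (?G v * exp (\<i> * of_real (y \<bullet> v)))
      = gaussian (\<lambda>b. \<zeta> b + (of_real (\<kappa> b))\<^sup>2 * z b)
          (\<lambda>b. of_real (y \<bullet> b) * (\<i> + of_real (\<kappa> b) * z b)) (\<lambda>b. - z b * of_real ((y \<bullet> b)\<^sup>2) / 2) v"
      unfolding gaussian_eq_exp euclidean_inner[of y v] exp_sum[OF finite_Basis, symmetric] exp_add[symmetric] of_real_sum sum_distrib_left sum.distrib[symmetric]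
      by (intro arg_cong[of _ _ exp] sum.cong refl)
         (use z in \<open>force simp: \<zeta>_def field_simps power2_eq_square\<close>)
    then show ?thesis
      unfolding eq using gaussian_integral[OF \<zeta>, where w="\<lambda>b. \<i> * of_real (y \<bullet> b - \<kappa> b * (v \<bullet> b))" and k="\<lambda>_. 0"]
      by (simp add: has_bochner_integral_iff prod.distrib mult_ac)
  qed
  have Re2: "0 < Re (\<zeta> b + (of_real (\<kappa> b))\<^sup>2 * z b)" if "b \<in> Basis" for b
    using \<zeta>[OF that] z[OF that] by (simp add: add_pos_nonneg flip: of_real_power)
  have "multiplier_op (coupling \<kappa>) (fourier (gaussian z (\<lambda>_. 0) (\<lambda>_. 0))) y
    = c\<^sup>2 * (\<Prod>b\<in>Basis. gauss_const (\<zeta> b)) * (\<Prod>b\<in>Basis. gauss_const (\<zeta> b + (of_real (\<kappa> b))\<^sup>2 * z b) *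
        exp ((of_real (y \<bullet> b) * (\<i> + of_real (\<kappa> b) * z b))\<^sup>2 / (2 * (\<zeta> b + (of_real (\<kappa> b))\<^sup>2 * z b)) + (- z b * of_real ((y \<bullet> b)\<^sup>2) / 2)))"
  proof -
    have "(LINT v|lborel. gaussian (\<lambda>b. \<zeta> b + (of_real (\<kappa> b))\<^sup>2 * z b)
          (\<lambda>b. of_real (y \<bullet> b) * (\<i> + of_real (\<kappa> b) * z b)) (\<lambda>b. - z b * of_real ((y \<bullet> b)\<^sup>2) / 2) v)
      = (\<Prod>b\<in>Basis. gauss_const (\<zeta> b + (of_real (\<kappa> b))\<^sup>2 * z b) *
        exp ((of_real (y \<bullet> b) * (\<i> + of_real (\<kappa> b) * z b))\<^sup>2 / (2 * (\<zeta> b + (of_real (\<kappa> b))\<^sup>2 * z b)) + (- z b * of_real ((y \<bullet> b)\<^sup>2) / 2)))"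
      by (rule has_bochner_integral_integral_eq[OF gaussian_integral]) (rule Re2)
    then show ?thesis unfolding multiplier_op_def F inner by simp
  qed
  also have "\<dots> = (\<Prod>b\<in>Basis. (gauss_const (z b))\<^sup>2 * gauss_const (1 / z b) * gauss_const (1 / z b + (of_real (\<kappa> b))\<^sup>2 * z b)
        * exp (of_real ((y \<bullet> b)\<^sup>2) * ((\<i> + of_real (\<kappa> b) * z b)\<^sup>2 / (2 * (1 / z b + (of_real (\<kappa> b))\<^sup>2 * z b)) - z b / 2)))"
    unfolding c_def \<zeta>_def power2_eq_square[of "prod _ _"] prod.distrib[symmetric]
    by (intro prod.cong refl) (simp add: power_mult_distrib power2_eq_square algebra_simps)
  finally show ?thesis .
qed

section \<open>Chirps\<close>

lemma prod_axis:
  fixes X Y :: "'b::comm_monoid_mult" and j :: "'n::finite"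
  shows "(\<Prod>b\<in>(Basis::(real^'n) set). if b = axis j 1 then X else Y) = X * Y ^ (CARD('n) - 1)"
proof -
  have e: "(axis j 1 :: real^'n) \<in> Basis" by simp
  have "(\<Prod>b\<in>(Basis::(real^'n) set). if b = axis j 1 then X else Y)
      = X * (\<Prod>b\<in>Basis - {axis j 1 :: real^'n}. if b = axis j 1 then X else Y)"
    using prod.remove[OF finite_Basis e, of "\<lambda>b. if b = axis j 1 then X else Y"] by simp
  also have "(\<Prod>b\<in>Basis - {axis j 1 :: real^'n}. if b = axis j 1 then X else Y) = (\<Prod>b\<in>Basis - {axis j 1 :: real^'n}. Y)"
    by (intro prod.cong) auto
  also have "\<dots> = Y ^ (CARD('n) - 1)" using e by (simp add: card_Diff_singleton)
  finally show ?thesis .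
qed

text \<open>
In direction \<open>j\<close> the Fourier transform is \<open>exp (- (\<mu> + i) u\<^sub>j\<^sup>2 / 2)\<close>, whose phase completes \<open>- u\<^sub>j v\<^sub>j\<close> to
\<open>- (u\<^sub>j + v\<^sub>j)\<^sup>2 / 2\<close>.
\<close>
definition chirp_param :: "'n::finite \<Rightarrow> real \<Rightarrow> real ^ 'n \<Rightarrow> complex" where
  "chirp_param j \<mu> b = (if b = axis j 1 then 1 / Complex \<mu> 1 else 1)"

text \<open>
The exponent of \<open>y\<^sub>j\<^sup>2\<close> in the output. Since \<open>\<zeta>\<^sup>2 + 1 = (\<zeta> - i) (\<zeta> + i)\<close> with \<open>\<zeta> - i = \<mu>\<close>, the small
factor cancels here, whereas it survives in the constant \<open>gauss_const (\<zeta> + 1 / \<zeta>)\<close>.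
\<close>
lemma chirp_exponent:
  assumes "0 < \<mu>"
  defines "\<zeta> \<equiv> Complex \<mu> 1"
  shows "(\<i> + 1 / \<zeta>)\<^sup>2 / (2 * (\<zeta> + 1 / \<zeta>)) - 1 / \<zeta> / 2 = - 1 / Complex \<mu> 2"
proof -
  have n0: "\<zeta> \<noteq> 0" using assms by (simp add: complex_eq_iff)
  have n1: "\<zeta> - \<i> \<noteq> 0" using assms by (simp add: complex_eq_iff)
  have n2: "\<zeta> + \<i> \<noteq> 0" using assms by (simp add: complex_eq_iff)
  have fac: "\<zeta>\<^sup>2 + 1 = (\<zeta> - \<i>) * (\<zeta> + \<i>)" by (simp add: power2_eq_square algebra_simps)
  have sq: "(\<i> * \<zeta> + 1)\<^sup>2 = - ((\<zeta> - \<i>) * (\<zeta> - \<i>))" by (simp add: power2_eq_square algebra_simps)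
  have "(\<i> + 1 / \<zeta>)\<^sup>2 / (2 * (\<zeta> + 1 / \<zeta>)) = (\<i> * \<zeta> + 1)\<^sup>2 / (2 * \<zeta> * (\<zeta>\<^sup>2 + 1))"
  proof -
    have "\<i> + 1 / \<zeta> = (\<i> * \<zeta> + 1) / \<zeta>" "\<zeta> + 1 / \<zeta> = (\<zeta>\<^sup>2 + 1) / \<zeta>"
      using n0 by (simp_all add: field_simps power2_eq_square)
    then show ?thesis using n0 by (simp add: power_divide power2_eq_square)
  qed
  also have "\<dots> = - (\<zeta> - \<i>) / (2 * \<zeta> * (\<zeta> + \<i>))"
  proof -
    have "- (a * a) / (2 * \<zeta> * (a * b)) = - a / (2 * \<zeta> * b)" if "a \<noteq> 0" for a b
      using that by simp
    then show ?thesis unfolding fac sq using n1 by blast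
  qed
  finally have "(\<i> + 1 / \<zeta>)\<^sup>2 / (2 * (\<zeta> + 1 / \<zeta>)) - 1 / \<zeta> / 2 = - (\<zeta> - \<i>) / (2 * \<zeta> * (\<zeta> + \<i>)) - 1 / \<zeta> / 2"
    by simp
  also have "\<dots> = - 1 / (\<zeta> + \<i>)"
  proof -
    have "1 / \<zeta> / 2 = (\<zeta> + \<i>) / (2 * \<zeta> * (\<zeta> + \<i>))"
      using n2 by simp
    then have "- (\<zeta> - \<i>) / (2 * \<zeta> * (\<zeta> + \<i>)) - 1 / \<zeta> / 2 = (- (\<zeta> - \<i>) - (\<zeta> + \<i>)) / (2 * \<zeta> * (\<zeta> + \<i>))"
      by (simp only: diff_divide_distrib)
    also have "- (\<zeta> - \<i>) - (\<zeta> + \<i>) = 2 * \<zeta> * (- 1)" by simp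
    also have "2 * \<zeta> * (- 1) / (2 * \<zeta> * (\<zeta> + \<i>)) = - 1 / (\<zeta> + \<i>)"
      using n0 by (intro mult_divide_mult_cancel_left) auto
    finally show ?thesis .
  qed
  also have "\<zeta> + \<i> = Complex \<mu> 2" by (simp add: \<zeta>_def complex_eq_iff)
  finally show ?thesis .
qed

lemma Re_chirp_param: "Re (chirp_param j \<mu> b) = (if b = axis j 1 then \<mu> / (\<mu>\<^sup>2 + 1) else 1)"
  by (simp add: chirp_param_def Re_divide)

text \<open>
The output is a Gaussian of width about \<open>1 / sqrt \<mu>\<close> in direction \<open>j\<close>, like the input, but with an
amplitude that is larger by a factor of order \<open>1 / sqrt \<mu>\<close>: the quadratic coefficient \<open>\<zeta> + 1 / \<zeta> = (\<zeta>\<^sup>2 + 1) / \<zeta>\<close> of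
the second integration has size at most \<open>3 \<mu>\<close>, because the chirps cancel almost all of the
oscillation in that variable.
\<close>
lemma norm_limit_op_chirp:
  fixes j :: "'n::finite"
  assumes \<mu>: "0 < \<mu>" "\<mu> \<le> 1"
  obtains A where "1 / sqrt (3 * \<mu>) \<le> A"
    "\<And>y. norm (multiplier_op (coupling (axis_indicator j))
        (fourier (gaussian (chirp_param j \<mu>) (\<lambda>_. 0) (\<lambda>_. 0))) y)
     = A * (\<Prod>b\<in>Basis. exp (- (if b = axis j 1 then \<mu> / (\<mu>\<^sup>2 + 4) else 1) * (y \<bullet> b)\<^sup>2))"
proof -
  let ?z = "chirp_param j \<mu>"
  let ?g = "\<lambda>b. (norm (gauss_const (?z b)))\<^sup>2 * norm (gauss_const (1 / ?z b)) * norm (gauss_const (1 / ?z b + (of_real (axis_indicator j b))\<^sup>2 * ?z b))"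
  let ?\<zeta> = "Complex \<mu> 1"
  have \<zeta>0: "?\<zeta> \<noteq> 0" by (simp add: complex_eq_iff)
  define X where "X = (norm (gauss_const (1 / ?\<zeta>)))\<^sup>2 * norm (gauss_const ?\<zeta>) * norm (gauss_const (?\<zeta> + 1 / ?\<zeta>))"
  define Y where "Y = (norm (gauss_const 1))\<^sup>2 * norm (gauss_const 1) * norm (gauss_const 1)"
  have g: "?g b = (if b = axis j 1 then X else Y)" for b
    by (simp add: chirp_param_def axis_indicator_def X_def Y_def)
  have Y: "1 \<le> Y"
  proof -
    have "1 \<le> norm (gauss_const 1)" using pi_ge_two by (simp add: norm_gauss_const)
    then show ?thesis unfolding Y_def by (intro mult_ge1_I one_le_power) auto
  qed
  have X: "1 / sqrt (3 * \<mu>) \<le> X"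
  proof -
    have nz: "1 \<le> norm ?\<zeta>" by (simp add: cmod_def)
    have "norm (?\<zeta> + 1 / ?\<zeta>) = norm (?\<zeta>\<^sup>2 + 1) / norm ?\<zeta>"
      using \<zeta>0 by (simp add: field_simps power2_eq_square flip: norm_divide)
    moreover have "norm (?\<zeta>\<^sup>2 + 1) \<le> 3 * \<mu>"
    proof -
      \<comment> \<open>This factor \<open>\<mu>\<close> is what makes the amplitude large.\<close>
      have "?\<zeta>\<^sup>2 + 1 = of_real \<mu> * Complex \<mu> 2"
        by (simp add: complex_eq_iff power2_eq_square algebra_simps)
      moreover have "norm (Complex \<mu> 2) \<le> 3"
        using cmod_le[of "Complex \<mu> 2"] \<mu> by simp
      ultimately show ?thesis using \<mu> by (simp add: norm_mult mult.commute)
    qed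
    ultimately have le: "norm ?\<zeta> * norm (?\<zeta> + 1 / ?\<zeta>) \<le> 3 * \<mu>"
      using \<zeta>0 by simp
    have pos: "0 < norm (?\<zeta> + 1 / ?\<zeta>)"
      using \<mu> Re_inverse_pos[of ?\<zeta>] by (auto simp: complex_eq_iff)
    have p1: "1 \<le> 2 * pi" using pi_ge_two by simp
    have X': "X = 2 * pi * norm ?\<zeta> * ((2 * pi) * (1 / sqrt (norm ?\<zeta> * norm (?\<zeta> + 1 / ?\<zeta>))))"
    proof -
      let ?q = "norm ?\<zeta>" and ?r = "norm (?\<zeta> + 1 / ?\<zeta>)"
      have "(sqrt (2 * pi / norm (1 / ?\<zeta>)))\<^sup>2 = 2 * pi * ?q"
        by (simp add: norm_divide)
      moreover have "sqrt (2 * pi / ?q) * sqrt (2 * pi / ?r) = sqrt ((2 * pi)\<^sup>2 * (1 / (?q * ?r)))"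
        by (simp add: power2_eq_square flip: real_sqrt_mult)
      moreover have "sqrt ((2 * pi)\<^sup>2 * (1 / (?q * ?r))) = 2 * pi * (1 / sqrt (?q * ?r))"
        unfolding real_sqrt_mult[of "(2 * pi)\<^sup>2"] real_sqrt_abs real_sqrt_divide by simp
      ultimately show ?thesis unfolding X_def norm_gauss_const by (simp only: mult.assoc)
    qed
    have "1 / sqrt (3 * \<mu>) \<le> 1 / sqrt (norm ?\<zeta> * norm (?\<zeta> + 1 / ?\<zeta>))"
      using le pos nz by (intro divide_left_mono real_sqrt_le_mono mult_pos_pos) (auto simp: \<mu> zero_less_mult_iff)
    also have "\<dots> \<le> X"
    proof -
      have "1 * (1 * (1 / sqrt (norm ?\<zeta> * norm (?\<zeta> + 1 / ?\<zeta>)))) \<le> X"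
        unfolding X' by (intro mult_mono) (use p1 nz mult_mono[OF p1 nz] in auto)
      then show ?thesis by simp
    qed
    finally show ?thesis .
  qed
  define A where "A = X * Y ^ (CARD('n) - 1)"
  have "1 / sqrt (3 * \<mu>) \<le> A"
  proof -
    have "0 \<le> X" using X order.trans[OF _ X, of 0] \<mu> by simp
    then have "X * 1 \<le> A" unfolding A_def using Y by (intro mult_left_mono one_le_power) auto
    with X show ?thesis by simp
  qed
  moreover have "norm (multiplier_op (coupling (axis_indicator j))
        (fourier (gaussian (chirp_param j \<mu>) (\<lambda>_. 0) (\<lambda>_. 0))) y)
     = A * (\<Prod>b\<in>Basis. exp (- (if b = axis j 1 then \<mu> / (\<mu>\<^sup>2 + 4) else 1) * (y \<bullet> b)\<^sup>2))" for y
  proof -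
    have z: "0 < Re (?z b)" for b using \<mu> by (simp add: Re_chirp_param add_pos_nonneg)
    have ex: "norm (exp (of_real ((y \<bullet> b)\<^sup>2) * ((\<i> + of_real (axis_indicator j b) * ?z b)\<^sup>2 / (2 * (1 / ?z b + (of_real (axis_indicator j b))\<^sup>2 * ?z b)) - ?z b / 2)))
      = exp (- (if b = axis j 1 then \<mu> / (\<mu>\<^sup>2 + 4) else 1) * (y \<bullet> b)\<^sup>2)" for b
    proof (cases "b = axis j 1")
      case True
      then have eq: "(\<i> + of_real (axis_indicator j b) * ?z b)\<^sup>2 / (2 * (1 / ?z b + (of_real (axis_indicator j b))\<^sup>2 * ?z b)) - ?z b / 2 = - 1 / Complex \<mu> 2"
        using chirp_exponent[OF \<mu>(1)] by (simp add: chirp_param_def axis_indicator_def)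
      show ?thesis unfolding eq using True by (simp add: norm_exp Re_divide mult.commute del: of_real_power)
    next
      case False
      then show ?thesis by (simp add: chirp_param_def axis_indicator_def norm_exp flip: of_real_power)
    qed
    have "norm (multiplier_op (coupling (axis_indicator j))
        (fourier (gaussian (chirp_param j \<mu>) (\<lambda>_. 0) (\<lambda>_. 0))) y)
      = (\<Prod>b\<in>Basis. ?g b * exp (- (if b = axis j 1 then \<mu> / (\<mu>\<^sup>2 + 4) else 1) * (y \<bullet> b)\<^sup>2))"
      by (subst multiplier_op_gaussian[OF z]) (simp only: prod_norm[symmetric] norm_mult norm_power ex)
    also have "\<dots> = A * (\<Prod>b\<in>Basis. exp (- (if b = axis j 1 then \<mu> / (\<mu>\<^sup>2 + 4) else 1) * (y \<bullet> b)\<^sup>2))"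
      unfolding prod.distrib g A_def prod_axis ..
    finally show ?thesis .
  qed
  ultimately show thesis by (rule that)
qed

text \<open>
Both sides of the bound contain the width of the Gaussians as the same factor \<open>1 / sqrt \<mu>\<close>, once
from the output and once from \<open>1 / p1 + 1 / p2 = 1 / p\<close> on the input side. What remains is a bound for the
amplitude of the output that does not depend on \<open>\<mu>\<close>, which fails as \<open>\<mu> \<rightarrow> 0\<close>.
\<close>
lemma limit_op_unbounded:
  fixes j :: "'n::finite"
  assumes p: "1 \<le> p" "1 \<le> p1" "1 \<le> p2" "1 / p = 1 / p1 + 1 / p2"
    and bound: "\<And>\<mu>. 0 < \<mu> \<Longrightarrow> \<mu> \<le> 1 \<Longrightarrow>
      (\<integral>\<^sup>+y. ennreal (norm (multiplier_op (coupling (axis_indicator j))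
        (fourier (gaussian (chirp_param j \<mu>) (\<lambda>_. 0) (\<lambda>_. 0))) y) powr p) \<partial>lborel)
    \<le> ennreal ((max 0 C * (\<Prod>b\<in>Basis. sqrt (2 * pi / (p1 * Re (chirp_param j \<mu> b)))) powr (1 / p1)
              * (\<Prod>b\<in>Basis. sqrt (2 * pi / (p2 * Re (chirp_param j \<mu> b)))) powr (1 / p2)) powr p)"
  shows False
proof -
  let ?m = "CARD('n) - 1"
  define d where "d q = sqrt (4 * pi / q) * sqrt (2 * pi / q) ^ ?m" for q
  define D where "D = (max 0 C * d p1 powr (1 / p1) * d p2 powr (1 / p2)) powr p"
  define c where "c = sqrt (4 * pi / p) * sqrt (pi / p) ^ ?m"
  have c0: "0 < c" using p by (simp add: c_def)
  have d0: "0 \<le> d q" if "1 \<le> q" for q using that by (simp add: d_def)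
  have key: "(1 / sqrt (3 * \<mu>)) powr p * c \<le> D" if \<mu>: "0 < \<mu>" "\<mu> \<le> 1" for \<mu>
  proof -
    obtain A where A: "1 / sqrt (3 * \<mu>) \<le> A"
      and S: "\<And>y. norm (multiplier_op (coupling (axis_indicator j))
        (fourier (gaussian (chirp_param j \<mu>) (\<lambda>_. 0) (\<lambda>_. 0))) y)
       = A * (\<Prod>b\<in>Basis. exp (- (if b = axis j 1 then \<mu> / (\<mu>\<^sup>2 + 4) else 1) * (y \<bullet> b)\<^sup>2))"
      using norm_limit_op_chirp[OF \<mu>] by blast
    have A0: "0 \<le> A" using A order.trans[OF _ A, of 0] \<mu> by simp
    let ?a = "\<lambda>b::real^'n. if b = axis j 1 then \<mu> / (\<mu>\<^sup>2 + 4) else 1"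
    let ?w = "1 / sqrt \<mu>"
    have lower: "(1 / sqrt (3 * \<mu>)) powr p * (c * ?w) \<le> A powr p * (\<Prod>b\<in>Basis. sqrt (pi / (p * ?a b)))"
    proof (intro mult_mono powr_mono2 A)
      have "(\<Prod>b\<in>Basis. sqrt (pi / (p * ?a b))) = (\<Prod>b\<in>Basis. if b = (axis j 1 :: real^'n) then sqrt (pi / (p * (\<mu> / (\<mu>\<^sup>2 + 4)))) else sqrt (pi / p))"
        by (intro prod.cong) auto
      also have "\<dots> = sqrt (pi / (p * (\<mu> / (\<mu>\<^sup>2 + 4)))) * sqrt (pi / p) ^ ?m"
        by (rule prod_axis)
      finally have eq: "(\<Prod>b\<in>Basis. sqrt (pi / (p * ?a b))) = sqrt (pi / (p * (\<mu> / (\<mu>\<^sup>2 + 4)))) * sqrt (pi / p) ^ ?m" .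
      have "sqrt (4 * pi / p) * ?w = sqrt (4 * pi / (p * \<mu>))"
        by (simp add: real_sqrt_divide real_sqrt_mult)
      also have "\<dots> \<le> sqrt (pi / (p * (\<mu> / (\<mu>\<^sup>2 + 4))))"
        using \<mu> p by (intro real_sqrt_le_mono) (simp add: field_simps)
      finally have "sqrt (4 * pi / p) * ?w * sqrt (pi / p) ^ ?m \<le> sqrt (pi / (p * (\<mu> / (\<mu>\<^sup>2 + 4)))) * sqrt (pi / p) ^ ?m"
        using p by (intro mult_right_mono) auto
      then show "c * ?w \<le> (\<Prod>b\<in>Basis. sqrt (pi / (p * ?a b)))"
        unfolding eq c_def by (simp add: mult_ac)
    qed (use p \<mu> c0 in auto)
    have upper: "(\<Prod>b\<in>Basis. sqrt (2 * pi / (q * Re (chirp_param j \<mu> b)))) powr (1 / q) \<le> d q powr (1 / q) * ?w powr (1 / q)"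
      if q: "1 \<le> q" for q
    proof -
      have "(\<Prod>b\<in>Basis. sqrt (2 * pi / (q * Re (chirp_param j \<mu> b)))) = (\<Prod>b\<in>Basis. if b = (axis j 1 :: real^'n) then sqrt (2 * pi / (q * (\<mu> / (\<mu>\<^sup>2 + 1)))) else sqrt (2 * pi / q))"
        by (intro prod.cong) (auto simp: Re_chirp_param)
      also have "\<dots> = sqrt (2 * pi / (q * (\<mu> / (\<mu>\<^sup>2 + 1)))) * sqrt (2 * pi / q) ^ ?m"
        by (rule prod_axis)
      also have "\<dots> \<le> sqrt (4 * pi / (q * \<mu>)) * sqrt (2 * pi / q) ^ ?m"
      proof (intro mult_right_mono real_sqrt_le_mono)
        have "\<mu>\<^sup>2 \<le> 1" using \<mu> by (simp add: power_le_one)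
        then show "2 * pi / (q * (\<mu> / (\<mu>\<^sup>2 + 1))) \<le> 4 * pi / (q * \<mu>)"
          using \<mu> q by (simp add: field_simps)
      qed (use q in auto)
      also have "\<dots> = d q * ?w"
        by (simp add: d_def real_sqrt_divide real_sqrt_mult)
      finally have "(\<Prod>b\<in>Basis. sqrt (2 * pi / (q * Re (chirp_param j \<mu> b)))) \<le> d q * ?w" .
      moreover have "0 \<le> (\<Prod>b\<in>Basis. sqrt (2 * pi / (q * Re (chirp_param j \<mu> b))))"
        using \<mu> q by (intro prod_nonneg) (auto simp: Re_chirp_param add_pos_nonneg)
      ultimately show ?thesis
        using q d0[OF q] \<mu> by (simp add: powr_mono2 flip: powr_mult)
    qed
    have "ennreal (A powr p * (\<Prod>b\<in>Basis. sqrt (pi / (p * ?a b))))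
      = (\<integral>\<^sup>+y. ennreal (norm (multiplier_op (coupling (axis_indicator j))
        (fourier (gaussian (chirp_param j \<mu>) (\<lambda>_. 0) (\<lambda>_. 0))) y) powr p) \<partial>lborel)"
      by (rule nn_integral_product_gaussian[OF S A0, symmetric]) (use \<mu> p in \<open>auto simp: add_pos_nonneg\<close>)
    also note bound[OF \<mu>]
    finally have "A powr p * (\<Prod>b\<in>Basis. sqrt (pi / (p * ?a b)))
      \<le> (max 0 C * (\<Prod>b\<in>Basis. sqrt (2 * pi / (p1 * Re (chirp_param j \<mu> b)))) powr (1 / p1)
              * (\<Prod>b\<in>Basis. sqrt (2 * pi / (p2 * Re (chirp_param j \<mu> b)))) powr (1 / p2)) powr p"
      by (simp add: ennreal_le_iff)
    also have "\<dots> \<le> (max 0 C * (d p1 powr (1 / p1) * ?w powr (1 / p1)) * (d p2 powr (1 / p2) * ?w powr (1 / p2))) powr p"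
      using p by (intro powr_mono2 mult_mono upper order.refl) auto
    also have "max 0 C * (d p1 powr (1 / p1) * ?w powr (1 / p1)) * (d p2 powr (1 / p2) * ?w powr (1 / p2))
      = (max 0 C * d p1 powr (1 / p1) * d p2 powr (1 / p2)) * ?w powr (1 / p)"
      unfolding p(4) powr_add by (simp only: mult_ac)
    also have "\<dots> powr p = D * ?w"
    proof -
      have "(?w powr (1 / p)) powr p = ?w powr (1 / p * p)" by (simp only: powr_powr)
      also have "\<dots> = ?w" using p(1) \<mu> by simp
      finally show ?thesis by (simp only: D_def powr_mult)
    qed
    finally have "(1 / sqrt (3 * \<mu>)) powr p * (c * ?w) \<le> D * ?w" using lower by linarith
    then show ?thesis using \<mu> by (simp add: field_simps)
  qed
  \<comment> \<open>The choice \<open>\<mu> = 1 / (3 t\<^sup>2)\<close> makes the amplitude bound equal to \<open>t\<close>.\<close>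
  define t where "t = max 1 (D / c + 1)"
  have t: "1 \<le> t" "D / c < t" by (auto simp: t_def)
  have "(1 / sqrt (3 * (1 / (3 * t\<^sup>2)))) powr p * c \<le> D"
  proof (rule key)
    have "1 \<le> t\<^sup>2" using t by simp
    then have "1 \<le> 3 * t\<^sup>2" by linarith
    then show "1 / (3 * t\<^sup>2) \<le> 1" by (subst divide_le_eq_1_pos) auto
  qed (use t in auto)
  moreover have "1 / sqrt (3 * (1 / (3 * t\<^sup>2))) = t"
    using t by (simp add: real_sqrt_divide)
  moreover have "t powr 1 \<le> t powr p" using t p by (intro powr_mono) auto
  ultimately have "t * c \<le> D" using t c0 by (smt (verit) mult_right_mono powr_one)
  then show False using t c0 by (simp add: field_simps)
qed

theorem theorem1:
  fixes \<rho> \<delta> p p1 p2 :: real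
  assumes "0 \<le> \<rho>" "\<rho> < 1" "0 \<le> \<delta>" "\<delta> \<le> 1"
    and "1 \<le> p" "1 \<le> p1" "1 \<le> p2"
    and "1 / p = 1 / p1 + 1 / p2"
  shows "\<exists>\<sigma> \<in> (BS 0 \<rho> \<delta> :: ((real ^ 'n) \<times> (real ^ 'n) \<times> (real ^ 'n) \<Rightarrow> complex) set).
    \<not> (\<exists>C::real. \<forall>f \<in> schwartz. \<forall>g \<in> schwartz.
         Lp_norm p (bilinear_op \<sigma> f g) \<le> ennreal C * Lp_norm p1 f * Lp_norm p2 g)"
proof -
  fix j :: 'n
  \<comment> \<open>The class only needs \<open>s \<le> 1 - \<rho>\<close>, but the mixed second derivative of the phase at \<open>(0, N e\<^sub>j)\<close> is
    proportional to \<open>s - 1\<close>; halving keeps it away from \<open>0\<close> when \<open>\<rho> = 0\<close>.\<close>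
  define s where "s = (1 - \<rho>) / 2"
  have s: "0 < s" "s < 1" "\<rho> \<le> 1 - s" using assms by (auto simp: s_def field_simps)
  show ?thesis
  proof (rule bexI[of _ "osc_symbol j s"])
    show "osc_symbol j s \<in> BS 0 \<rho> \<delta>" using assms s by (intro osc_symbol_in_BS) auto
    show "\<not> (\<exists>C::real. \<forall>f \<in> schwartz. \<forall>g \<in> schwartz.
         Lp_norm p (bilinear_op (osc_symbol j s) f g) \<le> ennreal C * Lp_norm p1 f * Lp_norm p2 g)"
    proof
      assume "\<exists>C::real. \<forall>f \<in> schwartz. \<forall>g \<in> schwartz.
         Lp_norm p (bilinear_op (osc_symbol j s) f g) \<le> ennreal C * Lp_norm p1 f * Lp_norm p2 g"
      then obtain C where C: "\<And>f g. f \<in> schwartz \<Longrightarrow> g \<in> schwartz \<Longrightarrow>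
         Lp_norm p (bilinear_op (osc_symbol j s) f g) \<le> ennreal C * Lp_norm p1 f * Lp_norm p2 g" by blast
      show False
      proof (rule limit_op_unbounded[OF assms(5-8)])
        fix \<mu> :: real assume \<mu>: "0 < \<mu>" "\<mu> \<le> 1"
        show "(\<integral>\<^sup>+y. ennreal (norm (multiplier_op (coupling (axis_indicator j))
          (fourier (gaussian (chirp_param j \<mu>) (\<lambda>_. 0) (\<lambda>_. 0))) y) powr p) \<partial>lborel)
          \<le> ennreal ((max 0 C * (\<Prod>b\<in>Basis. sqrt (2 * pi / (p1 * Re (chirp_param j \<mu> b)))) powr (1 / p1)
              * (\<Prod>b\<in>Basis. sqrt (2 * pi / (p2 * Re (chirp_param j \<mu> b)))) powr (1 / p2)) powr p)"
          using \<mu> assms by (intro limit_op_bounded[OF s(1,2) _ _ _ assms(8) C]) (auto simp: Re_chirp_param add_pos_nonneg)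
      qed
    qed
  qed
qed

end
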